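(* The distinguished $S^1$-fixed-point locus $E_0$ (the set of $S^1$-fixed points in $\psi^{-1}(Y_0)\subset\mathrm{HQuot}_P(\mathcal E^n)$) is given by $$E_0=\coprod_A E_{(A;0)},$$ where $A$ runs over all incomplete matrices $(\alpha_{i,j})_{1\le i\le I,\,1\le j\le r_i}$ such that the $i$-th row $(\alpha_{i,\bullet})$ is a partition $0\le\alpha_{i,1}\le\cdots\le\alpha_{i,r_i}$ of $d_i$ into non-negative integers of length $r_i$, and $\alpha_{i,j}\ge\alpha_{i+1,j}$ for $j=1,\ldots,r_i$ (and $1\le i\le I-1$). The set of such $A$ is always non-empty.
   Context: $\mathcal E^n=\mathcal O_{\mathbb{CP}^1}\otimes\mathbb C^n$; $d=(d_1,\ldots,d_I)$ with $d_i\ge0$; $P=(P_1,\ldots,P_I)$, $P_i(t)=(n-r_i)t+d_i+(n-r_i)$, $r_1<\cdots<r_I$; $\mathrm{HQuot}_P(\mathcal E^n)$ parameterizes inclusion sequences $\mathcal V_1\hookrightarrow\cdots\hookrightarrow\mathcal V_I\hookrightarrow\mathcal E^n$ of subsheaves with $\mathcal E^n/\mathcal V_i$ of Hilbert polynomial $P_i$ with respect to $\mathcal O(1)$. Let $[z_0:z_1]$ be homogeneous coordinates on $\mathbb{CP}^1$, $0=\{z_0=0\}$, $\infty=\{z_1=0\}$, $z=z_0/z_1$, $w=z^{-1}$, $U_0=\mathrm{Spec}\,\mathbb C[z]$, $U_\infty=\mathrm{Spec}\,\mathbb C[w]$, with $S^1$ acting by $z\mapsto e^{i\theta}z$. An $S^1$-invariant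 subsheaf $\mathcal V\subset\mathcal E^n$ of rank $r$ has discrete data $(\alpha_\bullet;\beta_\bullet)$: integer sequences $0\le\alpha_1\le\cdots\le\alpha_r$, $0\le\beta_1\le\cdots\le\beta_r$ such that for suitable bases $e_j$, $e'_j$ of a common $r$-dimensional subspace of $\mathbb C^n$, $\mathcal V|_{U_0}$ is freely generated by $z^{\alpha_j}e_j$ and $\mathcal V|_{U_\infty}$ is freely generated by $w^{\beta_j}e'_j$. $E_{(A;0)}$ is the $S^1$-fixed-point component consisting of chains of $S^1$-invariant subsheaves in which $\mathcal V_i$ has discrete data $(\alpha_{i,\bullet};0,\ldots,0)$. $W_d=\prod_{i=1}^I\mathbb P(H^0(\mathbb{CP}^1,\mathcal O(d_i))\otimes\Lambda^{r_i}\mathbb C^n)$, and $\psi:\mathrm{HQuot}_P(\mathcal E^n)\to W_d$ has $i$-th component given by the $r_i\times r_i$ minors of $\mathcal V_i\hookrightarrow\mathcal E^n$, i.e. by $\det\mathcal V_i\simeq\mathcal O(-d_i)\to\mathcal O\otimes\Lambda^{r_i}\mathbb C^n$. $Y_0\subset W_d$ is the $S^1$-fixed-point component of points whose $i$-th factor is of the form $[z_0^{d_i}\otimes v_i]$, $0\neq v_i\in\Lambda^{r_i}\mathbb C^n$, for every $i$. An incomplete matrix is one with rows of different lengths. *)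

theory Defs
  imports
    "Jordan_Normal_Form.VS_Connect"
    "Jordan_Normal_Form.DL_Submatrix"
    "HOL-Library.Disjoint_Sets"
    Complex_Main
begin

text \<open>
  A quasi-coherent subsheaf of the trivial bundle of rank n on the projective line is given by its
  modules of sections over the two charts \<open>Spec C[z]\<close> and \<open>Spec C[w]\<close>, \<open>w = 1/z\<close>.  Both are sets of
  vectors of polynomials, the polynomial variable being z in the first component of the pair and w
  in the second.
\<close>

type_synonym sheaf = "complex poly vec set \<times> complex poly vec set"

definition ev :: "complex poly vec \<Rightarrow> complex \<Rightarrow> complex vec" where
  "ev s x = map_vec (\<lambda>p. poly p x) s"

text \<open>
  Polynomials are determined by their values at the nonzero points, so an identity of sections over
  the overlap, i.e. of Laurent polynomials, is written as an identity of values.  A Laurent vector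
  (a function of the coordinate of one chart) lies in the localization \<open>M[1/x]\<close> of the module of that
  chart iff some multiple of it by a power of the coordinate lies in M.
\<close>

definition in_localization :: "complex poly vec set \<Rightarrow> (complex \<Rightarrow> complex vec) \<Rightarrow> bool" where
  "in_localization M f \<longleftrightarrow> (\<exists>N::nat. \<exists>s\<in>M. \<forall>x. x \<noteq> 0 \<longrightarrow> ev s x = x ^ N \<cdot>\<^sub>v f x)"

definition subsheaves :: "nat \<Rightarrow> sheaf set" where
  "subsheaves n = {(M0, Minf).
     submodule class_ring M0 (module_vec TYPE(complex poly) n) \<and>
     submodule class_ring Minf (module_vec TYPE(complex poly) n) \<and>
     (\<forall>s\<in>M0. in_localization Minf (\<lambda>w. ev s (1 / w))) \<and>
     (\<forall>t\<in>Minf. in_localization M0 (\<lambda>z. ev t (1 / z)))}"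

definition subsheaf_le :: "sheaf \<Rightarrow> sheaf \<Rightarrow> bool" where
  "subsheaf_le V V' \<longleftrightarrow> fst V \<subseteq> fst V' \<and> snd V \<subseteq> snd V'"

definition chains :: "nat \<Rightarrow> sheaf list set" where
  "chains n = {Vs. set Vs \<subseteq> subsheaves n \<and>
     (\<forall>i. Suc i < length Vs \<longrightarrow> subsheaf_le (Vs ! i) (Vs ! Suc i))}"

text \<open>
  Let Q be the quotient of the trivial bundle by V.  A global section of Q(m) is a pair of classes
  of vectors a(z) and b(w) modulo the two modules of V such that \<open>a(z) = z^m b(1/z)\<close> in Q over the
  overlap.  The set below consists of the pairs (a, b) themselves, so \<open>H^0(Q(m))\<close> is its quotient by
  \<open>fst V \<times> snd V\<close>.
\<close>

definition quotient_sections :: "nat \<Rightarrow> sheaf \<Rightarrow> nat \<Rightarrow> (complex poly vec \<times> complex poly vec) set"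
  where
  "quotient_sections n V m = {(a, b). a \<in> carrier_vec n \<and> b \<in> carrier_vec n \<and>
     in_localization (fst V) (\<lambda>z. ev a z - z ^ m \<cdot>\<^sub>v ev b (1 / z))}"

text \<open>
  \<open>H^0(Q(m))\<close> has dimension k: the classes of k pairs of columns \<open>(col Ca j, col Cb j)\<close> form a basis.
\<close>

definition h0_quotient_eq :: "nat \<Rightarrow> sheaf \<Rightarrow> nat \<Rightarrow> nat \<Rightarrow> bool" where
  "h0_quotient_eq n V m k \<longleftrightarrow> (\<exists>Ca\<in>carrier_mat n k. \<exists>Cb\<in>carrier_mat n k.
     (\<forall>j<k. (col Ca j, col Cb j) \<in> quotient_sections n V m) \<and>
     (\<forall>(a, b)\<in>quotient_sections n V m. \<exists>!l. l \<in> carrier_vec k \<and>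
        a - Ca *\<^sub>v map_vec (\<lambda>c. [:c:]) l \<in> fst V \<and>
        b - Cb *\<^sub>v map_vec (\<lambda>c. [:c:]) l \<in> snd V))"

text \<open>The Hilbert polynomial is the polynomial whose value at m is \<open>dim H^0(Q(m))\<close> for large m.\<close>

definition quotient_hilbert_poly :: "nat \<Rightarrow> sheaf \<Rightarrow> int poly \<Rightarrow> bool" where
  "quotient_hilbert_poly n V P \<longleftrightarrow>
     (\<forall>\<^sub>F m in sequentially. \<exists>k. h0_quotient_eq n V m k \<and> int k = poly P (int m))"

definition hquot :: "nat \<Rightarrow> int poly list \<Rightarrow> sheaf list set" where
  "hquot n P = {Vs \<in> chains n. length Vs = length P \<and>
     (\<forall>i<length P. quotient_hilbert_poly n (Vs ! i) (P ! i))}"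

definition hilbert_polys :: "nat \<Rightarrow> nat list \<Rightarrow> nat list \<Rightarrow> int poly list" where
  "hilbert_polys n r d = map (\<lambda>i. [:int (d ! i) + (int n - int (r ! i)), int n - int (r ! i):])
     [0..<length r]"

text \<open>
  The rotation \<open>g: z \<mapsto> cis \<theta> z\<close> acts on sections by \<open>(g s)(z) = s(g\<inverse> z)\<close>; in the coordinate w it is
  \<open>w \<mapsto> cis (-\<theta>) w\<close>.
\<close>

definition scale_var :: "complex \<Rightarrow> complex poly vec \<Rightarrow> complex poly vec" where
  "scale_var c s = map_vec (\<lambda>p. pcompose p [:0, c:]) s"

definition rotate_sheaf :: "real \<Rightarrow> sheaf \<Rightarrow> sheaf" where
  "rotate_sheaf \<theta> V = (scale_var (cis (- \<theta>)) ` fst V, scale_var (cis \<theta>) ` snd V)"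

definition S1_fixed :: "sheaf list \<Rightarrow> bool" where
  "S1_fixed Vs \<longleftrightarrow> (\<forall>\<theta>. map (rotate_sheaf \<theta>) Vs = Vs)"

text \<open>The columns of the n by r matrix G form a basis of M over the ring of its entries.\<close>

definition free_basis :: "nat \<Rightarrow> nat \<Rightarrow> 'a::comm_ring_1 mat \<Rightarrow> 'a vec set \<Rightarrow> bool" where
  "free_basis n r G M \<longleftrightarrow> G \<in> carrier_mat n r \<and> bij_betw (\<lambda>x. G *\<^sub>v x) (carrier_vec r) M"

definition twisted_columns :: "complex mat \<Rightarrow> nat list \<Rightarrow> complex poly mat" where
  "twisted_columns E a = mat (dim_row E) (dim_col E) (\<lambda>(k, j). monom (E $$ (k, j)) (a ! j))"

definition discrete_data :: "nat \<Rightarrow> sheaf \<Rightarrow> nat list \<Rightarrow> nat list \<Rightarrow> bool" where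
  "discrete_data n V a b \<longleftrightarrow> sorted a \<and> sorted b \<and> length a = length b \<and>
     (\<exists>W E E'. free_basis n (length a) E W \<and> free_basis n (length a) E' W \<and>
        free_basis n (length a) (twisted_columns E a) (fst V) \<and>
        free_basis n (length a) (twisted_columns E' b) (snd V))"

definition fixed_component :: "nat \<Rightarrow> nat list list \<Rightarrow> nat list list \<Rightarrow> sheaf list set" where
  "fixed_component n A B = {Vs \<in> chains n. S1_fixed Vs \<and> length Vs = length A \<and>
     (\<forall>i<length A. discrete_data n (Vs ! i) (A ! i) (B ! i))}"

definition zero_matrix_like :: "nat list list \<Rightarrow> nat list list" where
  "zero_matrix_like A = map (\<lambda>a. replicate (length a) 0) A"

text \<open>
  The r-th exterior power of \<open>C^n\<close> is given in coordinates with respect to its standard basis, indexed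
  by the r-element subsets of \<open>{..<n}\<close>; an element of \<open>H^0(O(d)) \<otimes> \<Lambda>^r C^n\<close> is then a family of
  binary forms of degree d in (z0, z1) with the same index set.  Coordinates are extended by 0.
\<close>

definition minor_index :: "nat \<Rightarrow> nat \<Rightarrow> nat set set" where
  "minor_index n r = {S. S \<subseteq> {..<n} \<and> card S = r}"

definition ext_power :: "nat \<Rightarrow> nat \<Rightarrow> (nat set \<Rightarrow> complex) set" where
  "ext_power n r = {v. \<forall>S. S \<notin> minor_index n r \<longrightarrow> v S = 0}"

definition binary_forms :: "nat \<Rightarrow> (complex \<Rightarrow> complex \<Rightarrow> complex) set" where
  "binary_forms d = {f. \<exists>c. f = (\<lambda>z0 z1. \<Sum>k\<le>d. c k * z0 ^ k * z1 ^ (d - k))}"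

type_synonym form_vec = "nat set \<Rightarrow> complex \<Rightarrow> complex \<Rightarrow> complex"

definition form_vecs :: "nat \<Rightarrow> nat \<Rightarrow> nat \<Rightarrow> form_vec set" where
  "form_vecs n r d = {f. (\<forall>S\<in>minor_index n r. f S \<in> binary_forms d) \<and>
     (\<forall>S. S \<notin> minor_index n r \<longrightarrow> f S = (\<lambda>z0 z1. 0))}"

definition proj_point :: "form_vec \<Rightarrow> form_vec set" where
  "proj_point f = {\<lambda>S z0 z1. c * f S z0 z1 | c. c \<noteq> 0}"

definition W_space :: "nat \<Rightarrow> nat list \<Rightarrow> nat list \<Rightarrow> form_vec set list set" where
  "W_space n r d = {y. length y = length r \<and> (\<forall>i<length r.
     \<exists>f\<in>form_vecs n (r ! i) (d ! i). f \<noteq> (\<lambda>S z0 z1. 0) \<and> y ! i = proj_point f)}"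

text \<open>
  Free bases G and H of the two modules of V give the matrices of the inclusion of V over the two
  charts, and their minors are the images of the corresponding generators of \<open>det V\<close>.  The map
  \<open>O(-d) \<simeq> det V \<rightarrow> O \<otimes> \<Lambda>^r C^n\<close> is a section f of \<open>O(d) \<otimes> \<Lambda>^r C^n\<close>, restricted to the charts
  by z1 = 1 and z0 = 1.  It is determined by agreement with the minors up to a unit on each chart,
  i.e. up to a nonzero constant; the set below consists of all these f, i.e. it is the projective
  point \<open>\<psi>(V)\<close>.
\<close>

definition minor :: "nat set \<Rightarrow> complex poly mat \<Rightarrow> complex poly" where
  "minor S G = det (submatrix G S UNIV)"

definition psi_component :: "nat \<Rightarrow> nat \<Rightarrow> nat \<Rightarrow> sheaf \<Rightarrow> form_vec set" where
  "psi_component n r d V = {f \<in> form_vecs n r d. \<exists>G H c c'.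
     free_basis n r G (fst V) \<and> free_basis n r H (snd V) \<and> c \<noteq> 0 \<and> c' \<noteq> 0 \<and>
     (\<forall>S\<in>minor_index n r. \<forall>x. f S x 1 = c * poly (minor S G) x \<and>
                               f S 1 x = c' * poly (minor S H) x)}"

definition psi :: "nat \<Rightarrow> nat list \<Rightarrow> nat list \<Rightarrow> sheaf list \<Rightarrow> form_vec set list" where
  "psi n r d Vs = map (\<lambda>i. psi_component n (r ! i) (d ! i) (Vs ! i)) [0..<length r]"

definition Y0 :: "nat \<Rightarrow> nat list \<Rightarrow> nat list \<Rightarrow> form_vec set list set" where
  "Y0 n r d = {y \<in> W_space n r d. \<forall>i<length r. \<exists>v\<in>ext_power n (r ! i). v \<noteq> (\<lambda>S. 0) \<and>
     y ! i = proj_point (\<lambda>S z0 z1. z0 ^ (d ! i) * v S)}"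

definition E0 :: "nat \<Rightarrow> nat list \<Rightarrow> nat list \<Rightarrow> sheaf list set" where
  "E0 n r d = {Vs \<in> hquot n (hilbert_polys n r d). S1_fixed Vs \<and> psi n r d Vs \<in> Y0 n r d}"

text \<open>Incomplete matrices are lists of rows; rows and entries are numbered from 0.\<close>

definition index_matrices :: "nat list \<Rightarrow> nat list \<Rightarrow> nat list list set" where
  "index_matrices r d = {A. length A = length r \<and>
     (\<forall>i<length r. length (A ! i) = r ! i \<and> sorted (A ! i) \<and> sum_list (A ! i) = d ! i) \<and>
     (\<forall>i. Suc i < length r \<longrightarrow> (\<forall>j<r ! i. A ! i ! j \<ge> A ! Suc i ! j))}"

end

theory Submission
  imports Defs
begin

text \<open>
  A module over a chart that is invariant under all rotations is graded, so it is the sum of the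
  \<open>z\<^sup>k F\<^sub>k\<close> for an increasing sequence of subspaces \<open>F\<^sub>k\<close> of \<open>C\<^sup>n\<close>; a basis adapted to this filtration
  gives generators \<open>z\<^bsup>\<alpha>\<^sub>j\<^esup> e\<^sub>j\<close>.  The minors of these are \<open>z\<^bsup>\<alpha>\<^sub>1+\<dots>+\<alpha>\<^sub>r\<^esup>\<close> times those of the matrix of the
  \<open>e\<^sub>j\<close>, so the image under \<open>\<psi>\<close> is of the form \<open>[z\<^sub>0\<^sup>d \<otimes> v]\<close> exactly when \<open>\<beta> = 0\<close> and \<open>\<alpha>\<close> sums
  to d.  The dimension of \<open>F\<^sub>k\<close> is the number of exponents at most k; it grows along an inclusion, so
  the sorted exponents decrease.  Conversely, the Hilbert polynomial is computed from an explicit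
  basis of \<open>H\<^sup>0(Q(m))\<close>.
\<close>

section \<open>Free bases\<close>

text \<open>Nothing in the definition of a subsheaf says that its two modules are free; invariance
  under rotations yields explicit bases, found independently in each chart. Two facts tie them
  together. A vector \<open>v\<close> has some z^k v in one module exactly when it has some w^l v in
  the other, because powers of the coordinate are units over the overlap; so both bases come from
  the same subspace of C^n. And \<open>psi\<close> calibrates rank and degree:
  \<open>psi_component\<close> consists of forms realized by bases with r columns, so its being a
  projective point fixes the rank; in the w chart a positive exponent would make every minor vanish
  at w = 0, whereas z0^d restricts to 1; in the z chart the power of z is the degree.

  For the converse, \<beta> = 0 makes the quotient Q a direct sum of n - r copies of O and torsion
  sheaves at 0 of lengths given by \<alpha>, so h^0(Q(m)) has the expected value for every m.

  \<open>vec_submodule\<close> covers modules over C[z] and subspaces of C^n alike, and all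
  comparisons of rank over either ring rest on one fact about matrices with more columns than rows,
  \<open>inj_mat_le\<close>.\<close>

definition vec_submodule :: "nat \<Rightarrow> 'a::comm_ring_1 vec set \<Rightarrow> bool" where
  "vec_submodule n M \<longleftrightarrow> M \<subseteq> carrier_vec n \<and> 0\<^sub>v n \<in> M \<and>
     (\<forall>u\<in>M. \<forall>v\<in>M. u + v \<in> M) \<and> (\<forall>c. \<forall>v\<in>M. c \<cdot>\<^sub>v v \<in> M)"

definition inj_mat :: "'a::comm_ring_1 mat \<Rightarrow> bool" where
  "inj_mat A \<longleftrightarrow> (\<forall>x\<in>carrier_vec (dim_col A). A *\<^sub>v x = 0\<^sub>v (dim_row A) \<longrightarrow> x = 0\<^sub>v (dim_col A))"

lemma submodule_imp_vec_submodule: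
  "submodule class_ring M (module_vec TYPE('a::comm_ring_1) n) \<Longrightarrow> vec_submodule n M"
  unfolding submodule_def vec_submodule_def
  by (auto simp: class_ring_simps module_vec_simps)

lemma vec_submodule_minus:
  assumes "vec_submodule n M" "u \<in> M" "v \<in> M"
  shows "u - v \<in> M"
proof -
  have "u - v = u + (- 1) \<cdot>\<^sub>v v"
    using assms unfolding vec_submodule_def by (intro eq_vecI) auto
  then show ?thesis using assms unfolding vec_submodule_def by auto
qed

lemma vec_submodule_mult_mat_vec:
  fixes G :: "'a::comm_ring_1 mat"
  assumes M: "vec_submodule n M" and G: "G \<in> carrier_mat n r" and x: "x \<in> carrier_vec r"
    and cols: "\<And>j. j < r \<Longrightarrow> col G j \<in> M"
  shows "G *\<^sub>v x \<in> M"
proof -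
  have "vec n (\<lambda>i. \<Sum>j<J. G $$ (i, j) * x $ j) \<in> M" if "J \<le> r" for J
    using that
  proof (induction J)
    case 0
    have "vec n (\<lambda>i. \<Sum>j<0. G $$ (i, j) * x $ j) = 0\<^sub>v n"
      by auto
    then show ?case using M by (simp add: vec_submodule_def)
  next
    case (Suc J)
    have "vec n (\<lambda>i. \<Sum>j<Suc J. G $$ (i, j) * x $ j)
        = vec n (\<lambda>i. \<Sum>j<J. G $$ (i, j) * x $ j) + x $ J \<cdot>\<^sub>v col G J"
      using Suc.prems G by (intro eq_vecI) auto
    then show ?case using Suc M cols[of J] unfolding vec_submodule_def by auto
  qed
  from this[of r] have "vec n (\<lambda>i. \<Sum>j<r. G $$ (i, j) * x $ j) \<in> M" by simp
  also have "vec n (\<lambda>i. \<Sum>j<r. G $$ (i, j) * x $ j) = G *\<^sub>v x"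
    using G x by (intro eq_vecI) (auto simp: scalar_prod_def atLeast0LessThan)
  finally show ?thesis .
qed

text \<open>Zero rows pad \<open>A\<close> to a square matrix whose determinant vanishes, because
  its transpose kills a unit vector; over a domain a vanishing determinant produces a kernel vector.
  Assuming only \<open>idom\<close> lets this serve complex and polynomial matrices.\<close>

lemma inj_mat_le:
  fixes A :: "'a::idom mat"
  assumes A: "A \<in> carrier_mat n r" and inj: "inj_mat A"
  shows "r \<le> n"
proof (rule ccontr)
  assume "\<not> r \<le> n"
  then have "n < r" by simp
  define B where "B = mat r r (\<lambda>(i, j). if i < n then A $$ (i, j) else 0)"
  have B: "B \<in> carrier_mat r r" by (simp add: B_def)
  have "transpose_mat B *\<^sub>v unit_vec r n = 0\<^sub>v r"
    using \<open>n < r\<close> by (intro eq_vecI) (auto simp: B_def)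
  moreover have "unit_vec r n \<noteq> (0\<^sub>v r :: 'a vec)"
    using \<open>n < r\<close> by (metis index_unit_vec(2) index_zero_vec(1) zero_neq_one)
  ultimately have "det (transpose_mat B) = 0"
    using det_0_iff_vec_prod_zero[of "transpose_mat B" r] B by (auto intro!: exI[of _ "unit_vec r n"])
  then have "det B = 0" using det_transpose[OF B] by simp
  then obtain v where v: "v \<in> carrier_vec r" "v \<noteq> 0\<^sub>v r" "B *\<^sub>v v = 0\<^sub>v r"
    using det_0_iff_vec_prod_zero[OF B] by auto
  have "A *\<^sub>v v = 0\<^sub>v n"
  proof (intro eq_vecI)
    fix i assume i: "i < dim_vec (0\<^sub>v n :: 'a vec)"
    then have "(B *\<^sub>v v) $ i = row A i \<bullet> v"
      using \<open>n < r\<close> A v(1) by (auto simp: B_def scalar_prod_def intro!: sum.cong)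
    then show "(A *\<^sub>v v) $ i = 0\<^sub>v n $ i" using i v \<open>n < r\<close> A by auto
  qed (use A in auto)
  then show False using inj A v by (auto simp: inj_mat_def)
qed

lemma free_basis_iff:
  "free_basis n r G M \<longleftrightarrow> G \<in> carrier_mat n r \<and> inj_mat G \<and> (\<lambda>x. G *\<^sub>v x) ` carrier_vec r = M"
  (is "_ \<longleftrightarrow> ?R")
proof
  assume L: "free_basis n r G M"
  then have G: "G \<in> carrier_mat n r" by (simp add: free_basis_def)
  have "x = 0\<^sub>v r" if "x \<in> carrier_vec r" "G *\<^sub>v x = 0\<^sub>v n" for x
  proof -
    have "G *\<^sub>v 0\<^sub>v r = 0\<^sub>v n" using G by auto
    then show ?thesis using L that unfolding free_basis_def bij_betw_def inj_on_def
      by (metis zero_carrier_vec)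
  qed
  then show ?R using L G by (auto simp: inj_mat_def free_basis_def bij_betw_def)
next
  assume R: ?R
  then have G: "G \<in> carrier_mat n r" by simp
  have "x = y" if "x \<in> carrier_vec r" "y \<in> carrier_vec r" "G *\<^sub>v x = G *\<^sub>v y" for x y
  proof -
    have "G *\<^sub>v (x - y) = 0\<^sub>v n"
      using G that by (simp add: mult_minus_distrib_mat_vec)
    then have "x - y = 0\<^sub>v r" using R G that unfolding inj_mat_def by auto
    then have "\<And>i. i < r \<Longrightarrow> (x - y) $ i = 0" by simp
    then show ?thesis using that by (intro eq_vecI) auto
  qed
  then show "free_basis n r G M" using R by (auto simp: free_basis_def bij_betw_def inj_on_def)
qed

section \<open>Rank and change of basis\<close>

lemma free_basis_cancel:
  assumes "free_basis n r G M" "X \<in> carrier_mat r s" "Y \<in> carrier_mat r s" "G * X = G * Y"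
  shows "X = Y"
proof (rule mat_col_eqI)
  fix j assume j: "j < dim_col Y"
  have G: "G \<in> carrier_mat n r" using assms(1) by (simp add: free_basis_def)
  have "col (G * X) j = G *\<^sub>v col X j" "col (G * Y) j = G *\<^sub>v col Y j"
    using G assms(2,3) j by auto
  then have "G *\<^sub>v col X j = G *\<^sub>v col Y j" using assms(4) by simp
  then show "col X j = col Y j"
    using assms(1-3) j unfolding free_basis_def bij_betw_def inj_on_def
    by (metis carrier_matD(1) col_dim)
qed (use assms in auto)

lemma free_basis_col_mem:
  assumes "free_basis n r G M" "j < r"
  shows "col G j \<in> M"
proof -
  have "col G j = G *\<^sub>v unit_vec r j"
    using assms by (intro eq_vecI) (auto simp: free_basis_def)
  then show ?thesis using assms by (auto simp: free_basis_iff)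
qed

lemma free_basis_factor:
  assumes G: "free_basis n r G M" and H: "H \<in> carrier_mat n s"
    and cols: "\<And>j. j < s \<Longrightarrow> col H j \<in> M"
  shows "\<exists>U\<in>carrier_mat r s. H = G * U"
proof -
  have "\<forall>j. \<exists>u. j < s \<longrightarrow> u \<in> carrier_vec r \<and> col H j = G *\<^sub>v u"
    using cols G unfolding free_basis_iff by blast
  then obtain u where u: "\<And>j. j < s \<Longrightarrow> u j \<in> carrier_vec r \<and> col H j = G *\<^sub>v u j" by metis
  define U where "U = mat r s (\<lambda>(i, j). u j $ i)"
  have "col U j = u j" if "j < s" for j
    using u[OF that] that by (auto simp: U_def)
  then have "H = G * U"
    using u H G by (intro mat_col_eqI) (auto simp: U_def free_basis_def)
  then show ?thesis by (auto simp: U_def)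
qed

text \<open>Each basis factors through the other, and cancelling a basis on the left shows that the
  two transition matrices are mutually inverse; this forces equal ranks and a unit
  determinant.\<close>

lemma free_basis_unique:
  fixes G :: "'a::idom mat"
  assumes G: "free_basis n r G M" and H: "free_basis n s H M"
  shows "s = r \<and> (\<exists>U\<in>carrier_mat r r. H = G * U \<and> det U dvd 1)"
proof -
  have GH: "G \<in> carrier_mat n r" "H \<in> carrier_mat n s" using G H by (auto simp: free_basis_def)
  obtain U where U: "U \<in> carrier_mat r s" "H = G * U"
    using free_basis_factor[OF G GH(2)] free_basis_col_mem[OF H] by blast
  obtain V where V: "V \<in> carrier_mat s r" "G = H * V"
    using free_basis_factor[OF H GH(1)] free_basis_col_mem[OF G] by blast
  have "G * (U * V) = G * 1\<^sub>m r" using U V GH by (metis assoc_mult_mat right_mult_one_mat)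
  then have UV: "U * V = 1\<^sub>m r" using free_basis_cancel[OF G] U V by (metis mult_carrier_mat one_carrier_mat)
  have "H * (V * U) = H * 1\<^sub>m s" using U V GH by (metis assoc_mult_mat right_mult_one_mat)
  then have VU: "V * U = 1\<^sub>m s" using free_basis_cancel[OF H] U V by (metis mult_carrier_mat one_carrier_mat)
  have inj_left: "inj_mat X" if "X \<in> carrier_mat a b" "Y \<in> carrier_mat b a" "Y * X = 1\<^sub>m b"
    for X Y :: "'a mat" and a b
    unfolding inj_mat_def
  proof (intro ballI impI)
    fix x assume x: "x \<in> carrier_vec (dim_col X)" "X *\<^sub>v x = 0\<^sub>v (dim_row X)"
    have "x = (Y * X) *\<^sub>v x" using that x by simp
    also have "\<dots> = Y *\<^sub>v (X *\<^sub>v x)" by (rule assoc_mult_mat_vec) (use that x in auto)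
    also have "\<dots> = 0\<^sub>v b" using that x by (intro eq_vecI) auto
    finally show "x = 0\<^sub>v (dim_col X)" using that x by simp
  qed
  have "s \<le> r" "r \<le> s"
    using inj_mat_le[OF U(1) inj_left[OF U(1) V(1) VU]] inj_mat_le[OF V(1) inj_left[OF V(1) U(1) UV]] .
  then have "s = r" by simp
  moreover have "det U * det V = 1" using UV U V det_mult[of U r V] \<open>s = r\<close> by simp
  ultimately show ?thesis using U by (metis dvdI)
qed

lemma free_basis_mult:
  assumes G: "free_basis n r G M" and U: "U \<in> carrier_mat r r" "V \<in> carrier_mat r r"
    and inv: "U * V = 1\<^sub>m r" "V * U = 1\<^sub>m r"
  shows "free_basis n r (G * U) M"
proof -
  have Gc: "G \<in> carrier_mat n r" using G by (simp add: free_basis_def)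
  have "bij_betw (\<lambda>x. U *\<^sub>v x) (carrier_vec r) (carrier_vec r)"
  proof (rule bij_betw_byWitness[where f' = "\<lambda>x. V *\<^sub>v x"])
    show "\<forall>x\<in>carrier_vec r. V *\<^sub>v (U *\<^sub>v x) = x"
      using U inv by (metis assoc_mult_mat_vec one_mult_mat_vec)
    show "\<forall>x\<in>carrier_vec r. U *\<^sub>v (V *\<^sub>v x) = x"
      using U inv by (metis assoc_mult_mat_vec one_mult_mat_vec)
  qed (use U in auto)
  moreover have "bij_betw (\<lambda>x. G *\<^sub>v x) (carrier_vec r) M"
    using G by (simp add: free_basis_def)
  ultimately have "bij_betw ((\<lambda>x. G *\<^sub>v x) \<circ> (\<lambda>x. U *\<^sub>v x)) (carrier_vec r) M"
    by (rule bij_betw_trans)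
  then have "bij_betw (\<lambda>x. (G * U) *\<^sub>v x) (carrier_vec r) M"
    using Gc U by (subst bij_betw_cong[where g = "(\<lambda>x. G *\<^sub>v x) \<circ> (\<lambda>x. U *\<^sub>v x)"]) auto
  then show ?thesis using Gc U by (simp add: free_basis_def)
qed

lemma free_basis_vec_submodule:
  assumes "free_basis n r G M"
  shows "vec_submodule n M"
proof -
  have G: "G \<in> carrier_mat n r" and M: "M = (\<lambda>x. G *\<^sub>v x) ` carrier_vec r"
    using assms unfolding free_basis_iff by blast+
  have zero: "0\<^sub>v n \<in> M"
  proof -
    have "0\<^sub>v n = G *\<^sub>v 0\<^sub>v r" using G by (intro eq_vecI) (simp_all add: scalar_prod_def)
    then show ?thesis unfolding M by (rule image_eqI) simp
  qed
  have add: "G *\<^sub>v x + G *\<^sub>v y \<in> M" if "x \<in> carrier_vec r" "y \<in> carrier_vec r" for x y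
  proof -
    have "G *\<^sub>v x + G *\<^sub>v y = G *\<^sub>v (x + y)" using mult_add_distrib_mat_vec[OF G that] by simp
    moreover have "x + y \<in> carrier_vec r" using that by simp
    ultimately show ?thesis unfolding M by (rule image_eqI)
  qed
  have smult: "c \<cdot>\<^sub>v (G *\<^sub>v x) \<in> M" if "x \<in> carrier_vec r" for x c
  proof -
    have "c \<cdot>\<^sub>v (G *\<^sub>v x) = G *\<^sub>v (c \<cdot>\<^sub>v x)"
      using G that by (intro eq_vecI) auto
    moreover have "c \<cdot>\<^sub>v x \<in> carrier_vec r" using that by simp
    ultimately show ?thesis unfolding M by (rule image_eqI)
  qed
  have "M \<subseteq> carrier_vec n" using G unfolding M by auto
  then show ?thesis using zero add smult unfolding vec_submodule_def by (auto simp only: M)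
qed

text \<open>As long as the span is not all of \<open>F\<close>, a vector outside it can be adjoined,
  and \<open>inj_mat_le\<close> bounds the number of rounds. Keeping the old columns in place is
  essential: it lets bases be refined along a filtration and completed to an invertible
  matrix.\<close>

lemma extend_free_basis:
  fixes E :: "'a::field mat"
  assumes F: "vec_submodule n F"
    and "E \<in> carrier_mat n r" "inj_mat E" "\<And>j. j < r \<Longrightarrow> col E j \<in> F"
  shows "\<exists>s E'. r \<le> s \<and> free_basis n s E' F \<and> (\<forall>i<n. \<forall>j<r. E' $$ (i, j) = E $$ (i, j))"
  using assms(2-)
proof (induction "n - r" arbitrary: r E rule: less_induct)
  case less
  have sub: "(\<lambda>x. E *\<^sub>v x) ` carrier_vec r \<subseteq> F"
    using vec_submodule_mult_mat_vec[OF F less.prems(1)] less.prems(3) by blast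
  show ?case
  proof (cases "(\<lambda>x. E *\<^sub>v x) ` carrier_vec r = F")
    case True
    then have "free_basis n r E F" using less.prems by (simp add: free_basis_iff)
    then show ?thesis by blast
  next
    case False
    then obtain v where v: "v \<in> F" "v \<notin> (\<lambda>x. E *\<^sub>v x) ` carrier_vec r" using sub by blast
    have vn: "v \<in> carrier_vec n" using v F by (auto simp: vec_submodule_def)
    define E1 where "E1 = mat n (Suc r) (\<lambda>(i, j). if j < r then E $$ (i, j) else v $ i)"
    have E1: "E1 \<in> carrier_mat n (Suc r)" by (simp add: E1_def)
    have E1_mult: "E1 *\<^sub>v x = E *\<^sub>v vec_first x r + x $ r \<cdot>\<^sub>v v" if "x \<in> carrier_vec (Suc r)" for x
      using less.prems(1) that vn
      by (intro eq_vecI) (auto simp: E1_def scalar_prod_def vec_first_def mult.commute)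
    have "inj_mat E1"
      unfolding inj_mat_def
    proof (intro ballI impI)
      fix x assume "x \<in> carrier_vec (dim_col E1)" "E1 *\<^sub>v x = 0\<^sub>v (dim_row E1)"
      then have x: "x \<in> carrier_vec (Suc r)" and "E1 *\<^sub>v x = 0\<^sub>v n" using E1 by auto
      then have eq: "E *\<^sub>v vec_first x r + x $ r \<cdot>\<^sub>v v = 0\<^sub>v n" using E1_mult by simp
      \<comment> \<open>Otherwise the relation could be solved for \<open>v\<close>, which lies
        outside the span of \<open>E\<close>.\<close>
      have xr: "x $ r = 0"
      proof (rule ccontr)
        assume ne: "x $ r \<noteq> 0"
        have "v = E *\<^sub>v ((- inverse (x $ r)) \<cdot>\<^sub>v vec_first x r)"
        proof (intro eq_vecI)
          fix i assume "i < dim_vec (E *\<^sub>v (- inverse (x $ r) \<cdot>\<^sub>v vec_first x r))"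
          then have i: "i < n" using less.prems(1) by simp
          have "(E *\<^sub>v vec_first x r) $ i + x $ r * v $ i = (E *\<^sub>v vec_first x r + x $ r \<cdot>\<^sub>v v) $ i"
            using i less.prems(1) vn by simp
          also have "\<dots> = 0" unfolding eq using i by simp
          finally have "(E *\<^sub>v vec_first x r) $ i = - (x $ r * v $ i)" by (simp add: eq_neg_iff_add_eq_0)
          moreover have "(E *\<^sub>v (- inverse (x $ r) \<cdot>\<^sub>v vec_first x r)) $ i
              = - inverse (x $ r) * (E *\<^sub>v vec_first x r) $ i"
            using i less.prems(1) by simp
          ultimately show "v $ i = (E *\<^sub>v (- inverse (x $ r) \<cdot>\<^sub>v vec_first x r)) $ i"
            using ne by simp
        qed (use vn less.prems in auto)
        then show False using v(2) by auto
      qed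
      have "E *\<^sub>v vec_first x r = 0\<^sub>v n"
      proof (intro eq_vecI)
        fix i assume "i < dim_vec (0\<^sub>v n :: 'a vec)"
        then have i: "i < n" by simp
        show "(E *\<^sub>v vec_first x r) $ i = 0\<^sub>v n $ i"
          using arg_cong[OF eq, of "\<lambda>v. v $ i"] i vn less.prems(1) by (simp add: xr)
      qed (use less.prems(1) in simp)
      then have z: "vec_first x r = 0\<^sub>v r"
        using less.prems(1,2) unfolding inj_mat_def by auto
      have "x $ i = 0" if "i < Suc r" for i
        using arg_cong[OF z, of "\<lambda>v. v $ i"] that xr x
        by (cases "i = r") (auto simp: vec_first_def)
      then show "x = 0\<^sub>v (dim_col E1)" using x E1 by (intro eq_vecI) auto
    qed
    moreover have "col E1 j \<in> F" if "j < Suc r" for j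
    proof (cases "j < r")
      case True
      then have "col E1 j = col E j" using less.prems(1) by (intro eq_vecI) (auto simp: E1_def)
      then show ?thesis using less.prems(3) True by simp
    next
      case False
      then have "col E1 j = v" using vn that by (intro eq_vecI) (auto simp: E1_def)
      then show ?thesis using v by simp
    qed
    moreover have "n - Suc r < n - r" using inj_mat_le[OF E1 \<open>inj_mat E1\<close>] by simp
    ultimately obtain s E' where "Suc r \<le> s" "free_basis n s E' F"
      "\<forall>i<n. \<forall>j<Suc r. E' $$ (i, j) = E1 $$ (i, j)"
      using less.hyps[OF _ E1] by blast
    then show ?thesis by (intro exI[of _ s] exI[of _ E']) (auto simp: E1_def)
  qed
qed

lemma det_nonzero_inverse:
  fixes B :: "'a::field mat"
  assumes "B \<in> carrier_mat n n" "det B \<noteq> 0"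
  shows "\<exists>C\<in>carrier_mat n n. B * C = 1\<^sub>m n \<and> C * B = 1\<^sub>m n"
  using det_non_zero_imp_unit[OF assms] by (auto simp: Units_def ring_mat_def)

text \<open>An extension of \<open>E\<close> inside the whole space is compared with the standard
  basis, which makes it square with nonzero determinant. Its inverse provides coordinates in which
  the span of \<open>E\<close> is given by the first r entries.\<close>

lemma extend_to_invertible:
  fixes E :: "'a::field mat"
  assumes E: "free_basis n r E W"
  shows "\<exists>B C. B \<in> carrier_mat n n \<and> C \<in> carrier_mat n n \<and> B * C = 1\<^sub>m n \<and> C * B = 1\<^sub>m n \<and>
    (\<forall>i<n. \<forall>j<r. B $$ (i, j) = E $$ (i, j)) \<and> r \<le> n"
proof -
  have Ec: "E \<in> carrier_mat n r" "inj_mat E" using E by (auto simp: free_basis_iff)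
  have F: "vec_submodule n (carrier_vec n :: 'a vec set)" by (auto simp: vec_submodule_def)
  have "\<exists>s B. r \<le> s \<and> free_basis n s B (carrier_vec n) \<and> (\<forall>i<n. \<forall>j<r. B $$ (i, j) = E $$ (i, j))"
    by (rule extend_free_basis[OF F Ec]) (use Ec in auto)
  then obtain s B where B: "r \<le> s" "free_basis n s B (carrier_vec n)"
    "\<forall>i<n. \<forall>j<r. B $$ (i, j) = E $$ (i, j)" by blast
  have "inj_mat (1\<^sub>m n :: 'a mat)" by (auto simp: inj_mat_def)
  moreover have "(\<lambda>x. 1\<^sub>m n *\<^sub>v x) ` carrier_vec n = (carrier_vec n :: 'a vec set)"
    by (auto simp: image_iff)
  ultimately have one: "free_basis n n (1\<^sub>m n) (carrier_vec n :: 'a vec set)"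
    by (auto simp: free_basis_iff)
  from free_basis_unique[OF one B(2)] obtain U where
    U: "s = n" "U \<in> carrier_mat n n" "B = 1\<^sub>m n * U" "det U dvd 1" by blast
  have "B = U" using U(2,3) by simp
  moreover have "det U \<noteq> 0" using U(4) by auto
  ultimately have Bn: "B \<in> carrier_mat n n" "det B \<noteq> 0" using U(2) by simp_all
  obtain C where C: "C \<in> carrier_mat n n" "B * C = 1\<^sub>m n" "C * B = 1\<^sub>m n"
    using det_nonzero_inverse[OF Bn] by blast
  have "r \<le> n" using B(1) \<open>s = n\<close> by simp
  then show ?thesis
    by (intro exI[of _ B] exI[of _ C] conjI Bn(1) C B(3))
qed

section \<open>Graded modules\<close>

definition monom_vec :: "nat \<Rightarrow> 'a::comm_ring_1 vec \<Rightarrow> 'a poly vec" where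
  "monom_vec k v = map_vec (\<lambda>c. monom c k) v"

definition coeff_vec :: "'a::comm_ring_1 poly vec \<Rightarrow> nat \<Rightarrow> 'a vec" where
  "coeff_vec s k = map_vec (\<lambda>p. coeff p k) s"

lemma monom_vec_carrier [simp]: "monom_vec k v \<in> carrier_vec n \<longleftrightarrow> v \<in> carrier_vec n"
  by (simp add: monom_vec_def)

lemma coeff_vec_carrier [simp]: "coeff_vec s k \<in> carrier_vec n \<longleftrightarrow> s \<in> carrier_vec n"
  by (simp add: coeff_vec_def)

lemma monom_vec_add:
  "u \<in> carrier_vec n \<Longrightarrow> v \<in> carrier_vec n \<Longrightarrow> monom_vec k (u + v) = monom_vec k u + monom_vec k v"
  by (intro eq_vecI) (auto simp: monom_vec_def add_monom)

lemma monom_vec_smult: "monom_vec k (c \<cdot>\<^sub>v v) = [:c:] \<cdot>\<^sub>v monom_vec k v"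
  by (intro eq_vecI) (auto simp: monom_vec_def smult_monom)

lemma monom_vec_shift: "monom_vec (k + l) v = monom 1 l \<cdot>\<^sub>v monom_vec k v"
  by (intro eq_vecI) (auto simp: monom_vec_def mult_monom add.commute)

lemma monom_vec_mem_mono:
  assumes "vec_submodule n M" "monom_vec k v \<in> M" "k \<le> l"
  shows "monom_vec l v \<in> M"
  using assms monom_vec_shift[of k "l - k" v] by (auto simp: vec_submodule_def)

lemma vec_submodule_monom_vec:
  assumes M: "vec_submodule n M"
  shows "vec_submodule n {v \<in> carrier_vec n. monom_vec k v \<in> M}"
proof -
  have "monom_vec k (0\<^sub>v n) = (0\<^sub>v n :: 'a poly vec)"
    by (intro eq_vecI) (auto simp: monom_vec_def)
  then show ?thesis
    using M unfolding vec_submodule_def by (auto simp: monom_vec_add monom_vec_smult)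
qed

lemma sum_monom_vec_mem:
  fixes N :: "'a::comm_ring_1 poly vec set"
  assumes N: "vec_submodule n N" and s: "s \<in> carrier_vec n"
    and mem: "\<And>k. k < D \<Longrightarrow> monom_vec k (coeff_vec s k) \<in> N"
  shows "vec n (\<lambda>i. \<Sum>k<D. monom (coeff (s $ i) k) k) \<in> N"
  using mem
proof (induction D)
  case 0
  have "vec n (\<lambda>i. \<Sum>k<0::nat. monom (coeff (s $ i) k) k) = 0\<^sub>v n" by auto
  then show ?case using N by (simp add: vec_submodule_def)
next
  case (Suc D)
  have "vec n (\<lambda>i. \<Sum>k<Suc D. monom (coeff (s $ i) k) k)
      = vec n (\<lambda>i. \<Sum>k<D. monom (coeff (s $ i) k) k) + monom_vec D (coeff_vec s D)"
    using s by (intro eq_vecI) (auto simp: monom_vec_def coeff_vec_def)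
  then show ?case using Suc N by (simp add: vec_submodule_def)
qed

lemma coeff_vec_bounded:
  fixes s :: "'a::comm_ring_1 poly vec"
  assumes s: "s \<in> carrier_vec n"
  shows "\<exists>D. \<forall>i<n. \<forall>k\<ge>D. coeff (s $ i) k = 0"
proof (intro exI allI impI)
  fix i k assume i: "i < n" and k: "Suc (\<Sum>i<n. degree (s $ i)) \<le> k"
  have "degree (s $ i) \<le> (\<Sum>i<n. degree (s $ i))"
    using i by (intro member_le_sum) auto
  then show "coeff (s $ i) k = 0" using k by (intro coeff_eq_0) simp
qed

lemma sum_monom_vec_eq:
  fixes s :: "'a::comm_ring_1 poly vec"
  assumes s: "s \<in> carrier_vec n" and D: "\<forall>i<n. \<forall>k\<ge>D. coeff (s $ i) k = 0"
  shows "vec n (\<lambda>i. \<Sum>k<D. monom (coeff (s $ i) k) k) = s"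
proof (intro eq_vecI poly_eqI)
  fix i m assume i: "i < dim_vec s"
  show "coeff (vec n (\<lambda>i. \<Sum>k<D. monom (coeff (s $ i) k) k) $ i) m = coeff (s $ i) m"
    using i s D by (cases "m < D") (auto simp: coeff_sum)
qed (use s in auto)

lemma graded_module_mem:
  assumes N: "vec_submodule n N" and s: "s \<in> carrier_vec n"
    and mem: "\<And>k. monom_vec k (coeff_vec s k) \<in> N"
  shows "s \<in> N"
proof -
  obtain D where D: "\<forall>i<n. \<forall>k\<ge>D. coeff (s $ i) k = 0" using coeff_vec_bounded[OF s] by blast
  show ?thesis using sum_monom_vec_mem[OF N s mem, of D] sum_monom_vec_eq[OF s D] by simp
qed

section \<open>Rotation-invariant modules are graded\<close>

lemma coeff_scale_var:
  assumes "i < dim_vec s"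
  shows "coeff (scale_var c s $ i) k = c ^ k * coeff (s $ i) k"
  using assms by (simp add: scale_var_def coeff_pcompose_linear)

text \<open>
  If s has degree D and \<open>c\<^sup>i \<noteq> c\<^sup>D\<close> for all \<open>i < D\<close>, then \<open>s(cz) - c\<^sup>D s(z)\<close> has no term of degree D,
  and its other homogeneous parts are nonzero multiples of those of s.
\<close>

lemma rotation_invariant_graded:
  fixes M :: "complex poly vec set"
  assumes M: "vec_submodule n M" and rot: "\<And>\<theta> s. s \<in> M \<Longrightarrow> scale_var (cis \<theta>) s \<in> M"
    and s: "s \<in> M"
  shows "monom_vec k (coeff_vec s k) \<in> M"
proof -
  have carr: "t \<in> carrier_vec n" if "t \<in> M" for t using M that by (auto simp: vec_submodule_def)
  have "\<forall>s\<in>M. (\<forall>i<n. \<forall>k\<ge>D. coeff (s $ i) k = 0) \<longrightarrow> (\<forall>k. monom_vec k (coeff_vec s k) \<in> M)" for D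
  proof (induction D)
    case 0
    have "monom_vec k (coeff_vec s k) = 0\<^sub>v n"
      if "s \<in> M" "\<forall>i<n. \<forall>k. coeff (s $ i) k = 0" for s k
      using that carr[of s] by (intro eq_vecI) (auto simp: monom_vec_def coeff_vec_def)
    then show ?case using M by (auto simp: vec_submodule_def)
  next
    case (Suc D)
    show ?case
    proof (intro ballI impI allI)
      fix s k assume s: "s \<in> M" and deg: "\<forall>i<n. \<forall>k\<ge>Suc D. coeff (s $ i) k = 0"
      have sn: "s \<in> carrier_vec n" using s by (rule carr)
      \<comment> \<open>With D + 1 in the denominator, every difference D - i with i < D gives an
        angle strictly between 0 and pi, where the cosine is not 1; so \<open>c ^ i\<close> and
        \<open>c ^ D\<close> differ.\<close>
      define c where "c = cis (pi / Suc D)"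
      have c_ne: "c ^ i \<noteq> c ^ D" if "i < D" for i
      proof
        assume "c ^ i = c ^ D"
        moreover have "c ^ D = c ^ i * c ^ (D - i)" using that by (simp flip: power_add)
        moreover have "c \<noteq> 0" by (simp add: c_def)
        ultimately have "c ^ (D - i) = 1" by simp
        then have "cis (real (D - i) * (pi / Suc D)) = 1" by (simp only: c_def DeMoivre)
        then have "cos (real (D - i) * (pi / Suc D)) = cos 0"
          by (simp only: complex_eq_iff cis.sel one_complex.sel cos_zero)
        moreover have "real (D - i) * (pi / Suc D) \<le> pi"
        proof -
          have "real (D - i) * pi \<le> real (Suc D) * pi" using that by (intro mult_right_mono) auto
          then show ?thesis by (simp add: divide_simps mult.commute)
        qed
        ultimately have "real (D - i) * (pi / Suc D) = 0"
          using cos_inj_pi[of "real (D - i) * (pi / Suc D)" 0] by simp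
        then show False using that by simp
      qed
      define t where "t = scale_var c s - [:c ^ D:] \<cdot>\<^sub>v s"
      have tM: "t \<in> M"
        unfolding t_def using vec_submodule_minus[OF M rot[OF s]] M s c_def
        by (auto simp: vec_submodule_def)
      have coeff_t: "coeff (t $ i) k = (c ^ k - c ^ D) * coeff (s $ i) k" if "i < n" for i k
        using that sn by (simp add: t_def coeff_scale_var algebra_simps)
      have "coeff (t $ i) k = 0" if "i < n" "D \<le> k" for i k
        using that deg by (cases "k = D") (auto simp: coeff_t)
      then have t_comp: "monom_vec k (coeff_vec t k) \<in> M" for k using Suc tM by blast
      have low: "monom_vec k (coeff_vec s k) \<in> M" if "k < D" for k
      proof -
        have "monom_vec k (coeff_vec s k)
            = [:inverse (c ^ k - c ^ D):] \<cdot>\<^sub>v monom_vec k (coeff_vec t k)"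
        proof (intro eq_vecI)
          fix i assume "i < dim_vec ([:inverse (c ^ k - c ^ D):] \<cdot>\<^sub>v monom_vec k (coeff_vec t k))"
          then have "i < n" using carr[OF tM] by (simp add: monom_vec_def coeff_vec_def)
          then show "monom_vec k (coeff_vec s k) $ i
              = ([:inverse (c ^ k - c ^ D):] \<cdot>\<^sub>v monom_vec k (coeff_vec t k)) $ i"
            using sn carr[OF tM] c_ne[OF that]
            by (simp add: monom_vec_def coeff_vec_def coeff_t smult_monom)
        qed (use sn carr[OF tM] in \<open>auto simp: monom_vec_def coeff_vec_def\<close>)
        then show ?thesis using M t_comp by (simp add: vec_submodule_def)
      qed
      have zero: "monom_vec k (coeff_vec s k) = 0\<^sub>v n" if "k > D" for k
        using that deg sn by (intro eq_vecI) (auto simp: monom_vec_def coeff_vec_def)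
      \<comment> \<open>The induction hypothesis only speaks of \<open>t\<close>, which has lost the
        top degree; that part of \<open>s\<close> is what remains after subtracting the lower parts,
        already known to lie in \<open>M\<close>.\<close>
      have "monom_vec D (coeff_vec s D) = s - vec n (\<lambda>i. \<Sum>k<D. monom (coeff (s $ i) k) k)"
        (is "_ = s - ?l")
      proof (intro eq_vecI)
        fix i assume "i < dim_vec (s - ?l)"
        then have i: "i < n" by simp
        have "monom (coeff (s $ i) D) D + ?l $ i = s $ i"
          using arg_cong[OF sum_monom_vec_eq[OF sn deg], of "\<lambda>v. v $ i"] i by (simp add: add.commute)
        then have "monom (coeff (s $ i) D) D = s $ i - ?l $ i" by (rule add_implies_diff)
        then show "monom_vec D (coeff_vec s D) $ i = (s - ?l) $ i"
          using i sn by (simp add: monom_vec_def coeff_vec_def)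
      qed (use sn in \<open>auto simp: monom_vec_def coeff_vec_def\<close>)
      then have "monom_vec D (coeff_vec s D) \<in> M"
        using vec_submodule_minus[OF M s sum_monom_vec_mem[OF M sn low]] by simp
      then show "monom_vec k (coeff_vec s k) \<in> M"
        using low zero M by (cases k D rule: linorder_cases) (auto simp: vec_submodule_def)
    qed
  qed
  then show ?thesis using coeff_vec_bounded[OF carr[OF s]] s by blast
qed

section \<open>Modules generated by homogeneous columns\<close>

lemma twisted_columns_carrier [simp]:
  "twisted_columns E a \<in> carrier_mat n r \<longleftrightarrow> E \<in> carrier_mat n r"
  unfolding twisted_columns_def carrier_mat_def by simp

lemma col_twisted_columns:
  assumes "E \<in> carrier_mat n r" "j < r"
  shows "col (twisted_columns E a) j = monom_vec (a ! j) (col E j)"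
  using assms by (intro eq_vecI) (auto simp: twisted_columns_def monom_vec_def)

text \<open>Reduces polynomial relations to scalar ones, degree by degree. The case distinction
  guards against truncated subtraction: a column with exponent above \<open>k\<close> contributes
  nothing in degree \<open>k\<close>.\<close>

lemma coeff_vec_twisted_columns:
  assumes E: "E \<in> carrier_mat n r" and x: "x \<in> carrier_vec r"
  shows "coeff_vec (twisted_columns E a *\<^sub>v x) k
    = E *\<^sub>v vec r (\<lambda>j. if a ! j \<le> k then coeff (x $ j) (k - a ! j) else 0)"
  using E x
  by (intro eq_vecI)
    (auto simp: coeff_vec_def twisted_columns_def scalar_prod_def coeff_sum coeff_monom_mult
      intro!: sum.cong)

text \<open>Lifts a scalar relation back to the module in degree \<open>k\<close>; the support
  condition on \<open>y\<close> is what keeps the factors z^(k - a_j) polynomial.\<close>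

lemma monom_vec_twisted_columns:
  assumes E: "E \<in> carrier_mat n r" and y: "y \<in> carrier_vec r"
    and supp: "\<And>j. j < r \<Longrightarrow> k < a ! j \<Longrightarrow> y $ j = 0"
  shows "monom_vec k (E *\<^sub>v y) = twisted_columns E a *\<^sub>v vec r (\<lambda>j. monom (y $ j) (k - a ! j))"
proof (intro eq_vecI)
  fix i assume "i < dim_vec (twisted_columns E a *\<^sub>v vec r (\<lambda>j. monom (y $ j) (k - a ! j)))"
  then have i: "i < n" using E by (simp add: twisted_columns_def)
  have eq: "monom (E $$ (i, j)) (a ! j) * monom (y $ j) (k - a ! j) = monom (E $$ (i, j) * y $ j) k"
    if "j < r" for j
    using supp[OF that] by (cases "k < a ! j") (auto simp: mult_monom)
  have "monom_vec k (E *\<^sub>v y) $ i = monom (\<Sum>j<r. E $$ (i, j) * y $ j) k"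
    using i E y by (simp add: monom_vec_def scalar_prod_def atLeast0LessThan)
  also have "\<dots> = (\<Sum>j<r. monom (E $$ (i, j) * y $ j) k)"
    by (intro poly_eqI) (auto simp: coeff_sum)
  also have "\<dots> = (twisted_columns E a *\<^sub>v vec r (\<lambda>j. monom (y $ j) (k - a ! j))) $ i"
    using i E eq by (simp add: twisted_columns_def scalar_prod_def atLeast0LessThan)
  finally show "monom_vec k (E *\<^sub>v y) $ i
      = (twisted_columns E a *\<^sub>v vec r (\<lambda>j. monom (y $ j) (k - a ! j))) $ i" .
qed (use E in \<open>simp add: monom_vec_def twisted_columns_def\<close>)

lemma inj_mat_twisted_columns:
  assumes E: "E \<in> carrier_mat n r" and inj: "inj_mat E"
  shows "inj_mat (twisted_columns E a)"
  unfolding inj_mat_def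
proof (intro ballI impI)
  fix x assume x: "x \<in> carrier_vec (dim_col (twisted_columns E a))"
    and "twisted_columns E a *\<^sub>v x = 0\<^sub>v (dim_row (twisted_columns E a))"
  then have xr: "x \<in> carrier_vec r" and Tx: "twisted_columns E a *\<^sub>v x = 0\<^sub>v n"
    using E by (auto simp: twisted_columns_def)
  have "coeff (x $ j) m = 0" if j: "j < r" for j m
  proof -
    \<comment> \<open>Degree m + a_j is the one in which entry j of this vector is the m-th
      coefficient of \<open>x $ j\<close>.\<close>
    let ?y = "vec r (\<lambda>i. if a ! i \<le> m + a ! j then coeff (x $ i) (m + a ! j - a ! i) else 0)"
    have "E *\<^sub>v ?y = coeff_vec (0\<^sub>v n) (m + a ! j)"
      using coeff_vec_twisted_columns[OF E xr, of a "m + a ! j"] Tx by simp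
    also have "\<dots> = 0\<^sub>v n" by (intro eq_vecI) (auto simp: coeff_vec_def)
    finally have "?y = 0\<^sub>v r" using inj E by (auto simp: inj_mat_def)
    from arg_cong[OF this, of "\<lambda>v. v $ j"] show ?thesis using j by simp
  qed
  then show "x = 0\<^sub>v (dim_col (twisted_columns E a))"
    using xr E by (intro eq_vecI) (auto simp: twisted_columns_def poly_eq_iff)
qed

text \<open>Stage \<open>K\<close> of the degree filtration. The last clause says that for k \<le> K
  the columns with exponent at most k have F_k in their span; phrasing it through vanishing
  coordinates avoids forming submatrices of \<open>E\<close>.\<close>

definition adapted_basis ::
  "nat \<Rightarrow> complex poly vec set \<Rightarrow> nat \<Rightarrow> complex mat \<Rightarrow> nat list \<Rightarrow> bool" where
  "adapted_basis n M K E a \<longleftrightarrow> sorted a \<and> (\<forall>x\<in>set a. x \<le> K) \<and>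
     free_basis n (length a) E {v \<in> carrier_vec n. monom_vec K v \<in> M} \<and>
     (\<forall>j<length a. monom_vec (a ! j) (col E j) \<in> M) \<and>
     (\<forall>k\<le>K. \<forall>v\<in>carrier_vec n. monom_vec k v \<in> M \<longrightarrow>
        (\<exists>y\<in>carrier_vec (length a). v = E *\<^sub>v y \<and> (\<forall>j<length a. k < a ! j \<longrightarrow> y $ j = 0)))"

lemma adapted_basis_0:
  assumes M: "vec_submodule n M"
  shows "\<exists>E a. adapted_basis n M 0 E a"
proof -
  have "\<exists>s E. 0 \<le> s \<and> free_basis n s E {v \<in> carrier_vec n. monom_vec 0 v \<in> M} \<and>
      (\<forall>i<n. \<forall>j<0. E $$ (i, j) = (0\<^sub>m n 0 :: complex mat) $$ (i, j))"
    by (rule extend_free_basis[OF vec_submodule_monom_vec[OF M]]) (auto simp: inj_mat_def)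
  then obtain s E where E: "free_basis n s E {v \<in> carrier_vec n. monom_vec 0 v \<in> M}" by blast
  have "adapted_basis n M 0 E (replicate s 0)"
    using E free_basis_col_mem[OF E] unfolding adapted_basis_def by (auto simp: free_basis_iff)
  then show ?thesis by blast
qed

text \<open>New columns are appended with exponent \<open>Suc K\<close>, so the list stays sorted
  and old coordinate vectors are merely padded with zeros. The clause on \<open>b = []\<close> is
  what lets the construction become stationary.\<close>

lemma adapted_basis_Suc:
  assumes M: "vec_submodule n M" and ad: "adapted_basis n M K E a"
  shows "\<exists>E' b. adapted_basis n M (Suc K) E' (a @ b) \<and> (b = [] \<longrightarrow> E' = E)"
proof -
  let ?F = "\<lambda>k. {v \<in> carrier_vec n. monom_vec k v \<in> M}"
  let ?r = "length a"
  have E: "free_basis n ?r E (?F K)" using ad by (simp add: adapted_basis_def)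
  then have Ec: "E \<in> carrier_mat n ?r" "inj_mat E" by (auto simp: free_basis_iff)
  have mono: "?F K \<subseteq> ?F (Suc K)" using monom_vec_mem_mono[OF M, of K _ "Suc K"] by auto
  have "\<exists>s E'. ?r \<le> s \<and> free_basis n s E' (?F (Suc K)) \<and> (\<forall>i<n. \<forall>j<?r. E' $$ (i, j) = E $$ (i, j))"
    by (rule extend_free_basis[OF vec_submodule_monom_vec[OF M] Ec])
      (use free_basis_col_mem[OF E] mono in blast)
  then obtain s E' where s: "?r \<le> s" and E': "free_basis n s E' (?F (Suc K))"
    and ext: "\<forall>i<n. \<forall>j<?r. E' $$ (i, j) = E $$ (i, j)" by blast
  have E'c: "E' \<in> carrier_mat n s" using E' by (simp add: free_basis_def)
  define b where "b = replicate (s - ?r) (Suc K)"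
  have len: "length (a @ b) = s" using s by (simp add: b_def)
  have nth: "(a @ b) ! j = (if j < ?r then a ! j else Suc K)" if "j < s" for j
    using that by (auto simp: b_def nth_append)
  have aK: "\<forall>x\<in>set a. x \<le> K" and sa: "sorted a" using ad by (auto simp: adapted_basis_def)
  have "sorted (a @ b)" using sa aK by (force simp: sorted_append b_def)
  moreover have "\<forall>x\<in>set (a @ b). x \<le> Suc K" using aK by (auto simp: b_def)
  moreover have "monom_vec ((a @ b) ! j) (col E' j) \<in> M" if j: "j < s" for j
  proof (cases "j < ?r")
    case True
    then have "col E' j = col E j" using ext E'c Ec s by (intro eq_vecI) auto
    then show ?thesis using True ad nth[OF j] by (simp add: adapted_basis_def)
  next
    case False
    then show ?thesis using free_basis_col_mem[OF E' j] nth[OF j] by simp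
  qed
  moreover have "\<exists>y\<in>carrier_vec s. v = E' *\<^sub>v y \<and> (\<forall>j<s. k < (a @ b) ! j \<longrightarrow> y $ j = 0)"
    if k: "k \<le> Suc K" and v: "v \<in> carrier_vec n" "monom_vec k v \<in> M" for k v
  proof (cases "k = Suc K")
    case True
    then obtain y where "y \<in> carrier_vec s" "v = E' *\<^sub>v y" using E' v by (auto simp: free_basis_iff)
    moreover have "\<not> Suc K < (a @ b) ! j" if "j < s" for j
      using nth[OF that] aK by (auto simp: not_less intro: le_SucI)
    ultimately show ?thesis using True by auto
  next
    case False
    then have "k \<le> K" using k by simp
    then obtain y where y: "y \<in> carrier_vec ?r" "v = E *\<^sub>v y" "\<forall>j<?r. k < a ! j \<longrightarrow> y $ j = 0"
      using ad v unfolding adapted_basis_def by blast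
    define y' where "y' = vec s (\<lambda>j. if j < ?r then y $ j else 0)"
    have "E' *\<^sub>v y' = v"
    proof (intro eq_vecI)
      fix i assume "i < dim_vec v"
      then have i: "i < n" using v by simp
      have "(E' *\<^sub>v y') $ i = (\<Sum>j<s. E' $$ (i, j) * (if j < ?r then y $ j else 0))"
        using i E'c by (simp add: y'_def scalar_prod_def atLeast0LessThan)
      also have "\<dots> = (\<Sum>j<?r. E $$ (i, j) * y $ j)"
        using s i ext by (intro sum.mono_neutral_cong_right) auto
      also have "\<dots> = v $ i" using i Ec y by (simp add: scalar_prod_def atLeast0LessThan)
      finally show "(E' *\<^sub>v y') $ i = v $ i" .
    qed (use E'c v in simp)
    moreover have "\<forall>j<s. k < (a @ b) ! j \<longrightarrow> y' $ j = 0" using y(3) nth by (simp add: y'_def)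
    ultimately show ?thesis by (intro bexI[of _ y']) (auto simp: y'_def)
  qed
  ultimately have "adapted_basis n M (Suc K) E' (a @ b)"
    unfolding adapted_basis_def len using E' by blast
  moreover have "E' = E" if "b = []"
  proof -
    have "s = ?r" using that len by simp
    then show ?thesis using E'c Ec ext by (intro eq_matI) auto
  qed
  ultimately show ?thesis by blast
qed

text \<open>An adapted basis of maximal length stays adapted in all higher degrees.\<close>

lemma adapted_basis_stable:
  assumes M: "vec_submodule n M"
  shows "\<exists>E a K0. \<forall>K\<ge>K0. adapted_basis n M K E a"
proof -
  define Q where "Q = (\<lambda>l. \<exists>K E a. adapted_basis n M K E a \<and> length a = l)"
  have bound: "l \<le> n" if Q: "Q l" for l
  proof -
    obtain K E a where "adapted_basis n M K E a" "length a = l" using Q unfolding Q_def by blast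
    then have "E \<in> carrier_mat n l" "inj_mat E" by (simp_all add: adapted_basis_def free_basis_iff)
    then show ?thesis by (rule inj_mat_le)
  qed
  obtain E0 a0 where "adapted_basis n M 0 E0 a0" using adapted_basis_0[OF M] by blast
  then have "Q (length a0)" unfolding Q_def by blast
  then have "Q (Greatest Q)" using bound by (rule GreatestI_nat)
  then obtain K0 E a where ad: "adapted_basis n M K0 E a" "length a = Greatest Q"
    unfolding Q_def by blast
  have max: "length b \<le> length a" if "adapted_basis n M K E' b" for K E' b
  proof -
    have "Q (length b)" using that unfolding Q_def by blast
    then show ?thesis unfolding ad(2) using bound by (rule Greatest_le_nat)
  qed
  have "adapted_basis n M K E a" if "K0 \<le> K" for K
    using that
  proof (induction K rule: dec_induct)
    case base
    then show ?case using ad by simp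
  next
    case (step K)
    obtain E' b where b: "adapted_basis n M (Suc K) E' (a @ b)" "b = [] \<longrightarrow> E' = E"
      using adapted_basis_Suc[OF M step.IH] by blast
    then have "b = []" using max[OF b(1)] by simp
    then show ?case using b by simp
  qed
  then show ?thesis by blast
qed

text \<open>A graded module is determined by its homogeneous elements, and a stable adapted basis
  expresses them in every degree. The span of \<open>E\<close> is described as the set of vectors
  occurring in some degree, since in this form it can be compared between the charts.\<close>

lemma graded_module_free_basis:
  assumes M: "vec_submodule n M" and graded: "\<And>s k. s \<in> M \<Longrightarrow> monom_vec k (coeff_vec s k) \<in> M"
  shows "\<exists>E a. sorted a \<and>
    free_basis n (length a) E {v \<in> carrier_vec n. \<exists>k. monom_vec k v \<in> M} \<and>
    free_basis n (length a) (twisted_columns E a) M"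
proof -
  obtain E a K0 where ad: "\<And>K. K0 \<le> K \<Longrightarrow> adapted_basis n M K E a"
    using adapted_basis_stable[OF M] by blast
  let ?r = "length a" and ?T = "twisted_columns E a"
  have E: "E \<in> carrier_mat n ?r" "inj_mat E"
    using ad[of K0] by (auto simp: adapted_basis_def free_basis_iff)
  \<comment> \<open>Stage \<open>max k K0\<close> is late enough to be stable and still covers
    degree \<open>k\<close>.\<close>
  have sol: "\<exists>y\<in>carrier_vec ?r. v = E *\<^sub>v y \<and> (\<forall>j<?r. k < a ! j \<longrightarrow> y $ j = 0)"
    if "v \<in> carrier_vec n" "monom_vec k v \<in> M" for v k
    using ad[of "max k K0"] that unfolding adapted_basis_def by (meson max.cobounded1 max.cobounded2)
  have "(\<lambda>x. E *\<^sub>v x) ` carrier_vec ?r = {v \<in> carrier_vec n. \<exists>k. monom_vec k v \<in> M}"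
  proof (intro subset_antisym subsetI)
    fix v assume "v \<in> (\<lambda>x. E *\<^sub>v x) ` carrier_vec ?r"
    then have "v \<in> {v \<in> carrier_vec n. monom_vec K0 v \<in> M}"
      using ad[of K0] by (auto simp: adapted_basis_def free_basis_iff)
    then show "v \<in> {v \<in> carrier_vec n. \<exists>k. monom_vec k v \<in> M}" by blast
  qed (use sol in blast)
  then have basis_E: "free_basis n ?r E {v \<in> carrier_vec n. \<exists>k. monom_vec k v \<in> M}"
    using E by (simp add: free_basis_iff)
  let ?N = "(\<lambda>x. ?T *\<^sub>v x) ` carrier_vec ?r"
  have T: "?T \<in> carrier_mat n ?r" "inj_mat ?T" using E inj_mat_twisted_columns by auto
  then have "free_basis n ?r ?T ?N" by (simp add: free_basis_iff)
  then have N: "vec_submodule n ?N" by (rule free_basis_vec_submodule)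
  have "?N = M"
  proof (intro subset_antisym subsetI)
    fix s assume "s \<in> ?N"
    then obtain x where x: "x \<in> carrier_vec ?r" "s = ?T *\<^sub>v x" by blast
    have "col ?T j \<in> M" if "j < ?r" for j
      using ad[of K0] that col_twisted_columns[OF E(1) that] by (auto simp: adapted_basis_def)
    then show "s \<in> M" using vec_submodule_mult_mat_vec[OF M T(1) x(1)] x(2) by blast
  next
    fix s assume s: "s \<in> M"
    then have sn: "s \<in> carrier_vec n" using M by (auto simp: vec_submodule_def)
    have "monom_vec k (coeff_vec s k) \<in> ?N" for k
    proof -
      obtain y where y: "y \<in> carrier_vec ?r" "coeff_vec s k = E *\<^sub>v y"
        "\<forall>j<?r. k < a ! j \<longrightarrow> y $ j = 0"
        using sol[OF _ graded[OF s]] sn by auto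
      show ?thesis
        using monom_vec_twisted_columns[OF E(1) y(1), of k a] y(3)
        by (intro image_eqI[of _ _ "vec ?r (\<lambda>j. monom (y $ j) (k - a ! j))"]) (auto simp: y(2))
    qed
    then show "s \<in> ?N" by (rule graded_module_mem[OF N sn])
  qed
  then show ?thesis using ad[of K0] basis_E T by (auto simp: adapted_basis_def free_basis_iff)
qed

text \<open>
  The vectors v with \<open>z\<^sup>k v\<close> in the module form a space of dimension equal to the number of exponents
  at most k, so these numbers, hence the exponents, can be compared along an inclusion.
\<close>

lemma twisted_exponents_antimono:
  assumes sub: "M \<subseteq> M'"
    and E: "E \<in> carrier_mat n r" "inj_mat E" "free_basis n r (twisted_columns E a) M" "length a = r"
    and E': "E' \<in> carrier_mat n s" "free_basis n s (twisted_columns E' b) M'" "length b = s"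
    and sorted: "sorted a" "sorted b" and j: "j < r"
  shows "j < s \<and> b ! j \<le> a ! j"
proof (rule ccontr)
  assume neg: "\<not> (j < s \<and> b ! j \<le> a ! j)"
  let ?k = "a ! j"
  \<comment> \<open>If j is an index of \<open>b\<close>, sortedness puts this exponent and all
    later ones above \<open>?k\<close>; if not, there is no such l.\<close>
  have large: "?k < b ! l" if "j \<le> l" "l < s" for l
  proof -
    have "b ! j \<le> b ! l" using sorted(2) that E' by (intro sorted_nth_mono) auto
    then show ?thesis using neg that by auto
  qed
  have M: "vec_submodule n M" using free_basis_vec_submodule[OF E(3)] .
  \<comment> \<open>Moved up to degree \<open>?k\<close>, the first j + 1 columns of
    \<open>E\<close> lie in \<open>M'\<close>, whose part in that degree involves only the first j
    columns of \<open>E'\<close>.\<close>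
  have "\<exists>y. y \<in> carrier_vec s \<and> col E i = E' *\<^sub>v y \<and> (\<forall>l<s. j \<le> l \<longrightarrow> y $ l = 0)" if i: "i \<le> j" for i
  proof -
    have ir: "i < r" using i j by simp
    have "monom_vec (a ! i) (col E i) \<in> M"
      using free_basis_col_mem[OF E(3) ir] col_twisted_columns[OF E(1) ir] by simp
    then have "monom_vec ?k (col E i) \<in> M'"
      using monom_vec_mem_mono[OF M] sorted_nth_mono[OF sorted(1) i] j E(4) sub by auto
    then obtain x where x: "x \<in> carrier_vec s" "monom_vec ?k (col E i) = twisted_columns E' b *\<^sub>v x"
      using E'(2) by (auto simp: free_basis_iff)
    have "col E i = coeff_vec (monom_vec ?k (col E i)) ?k"
      by (intro eq_vecI) (auto simp: coeff_vec_def monom_vec_def)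
    also have "\<dots> = E' *\<^sub>v vec s (\<lambda>l. if b ! l \<le> ?k then coeff (x $ l) (?k - b ! l) else 0)"
      unfolding x(2) by (rule coeff_vec_twisted_columns[OF E'(1) x(1)])
    finally show ?thesis
      by (intro exI[of _ "vec s (\<lambda>l. if b ! l \<le> ?k then coeff (x $ l) (?k - b ! l) else 0)"])
        (use large in force)
  qed
  then obtain y where y: "\<And>i. i \<le> j \<Longrightarrow> y i \<in> carrier_vec s" "\<And>i. i \<le> j \<Longrightarrow> col E i = E' *\<^sub>v y i"
    "\<And>i l. i \<le> j \<Longrightarrow> l < s \<Longrightarrow> j \<le> l \<Longrightarrow> y i $ l = 0" by metis
  \<comment> \<open>Coordinates of j + 1 independent vectors in at most j directions; when s < j the
    missing rows are filled with zeros.\<close>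
  define U where "U = mat j (Suc j) (\<lambda>(l, i). if l < s then y i $ l else 0)"
  have U: "U \<in> carrier_mat j (Suc j)" by (simp add: U_def)
  have "\<not> inj_mat U" using inj_mat_le[OF U] by auto
  then obtain x where x: "x \<in> carrier_vec (Suc j)" "U *\<^sub>v x = 0\<^sub>v j" "x \<noteq> 0\<^sub>v (Suc j)"
    using U by (auto simp: inj_mat_def)
  have yx: "(\<Sum>i\<le>j. y i $ l * x $ i) = 0" if l: "l < s" for l
  proof (cases "l < j")
    case True
    have "(\<Sum>i\<le>j. y i $ l * x $ i) = (U *\<^sub>v x) $ l"
      using True l x(1)
      by (simp add: U_def scalar_prod_def atLeast0LessThan lessThan_Suc_atMost)
    then show ?thesis using x(2) True by simp
  next
    case False
    then show ?thesis using y(3) l by (intro sum.neutral) auto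
  qed
  define x' where "x' = vec r (\<lambda>i. if i \<le> j then x $ i else 0)"
  have "E *\<^sub>v x' = 0\<^sub>v n"
  proof (intro eq_vecI)
    fix p assume "p < dim_vec (0\<^sub>v n :: complex vec)"
    then have p: "p < n" by simp
    have Ep: "E $$ (p, i) = (\<Sum>l<s. E' $$ (p, l) * y i $ l)" if "i \<le> j" for i
    proof -
      have "E $$ (p, i) = col E i $ p" using p that j E(1) by simp
      also have "\<dots> = (E' *\<^sub>v y i) $ p" using y(2)[OF that] by simp
      also have "\<dots> = (\<Sum>l<s. E' $$ (p, l) * y i $ l)"
        using p E'(1) y(1)[OF that] by (simp add: scalar_prod_def atLeast0LessThan)
      finally show ?thesis .
    qed
    have "(E *\<^sub>v x') $ p = (\<Sum>i<r. E $$ (p, i) * (if i \<le> j then x $ i else 0))"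
      using p E(1) by (simp add: x'_def scalar_prod_def atLeast0LessThan)
    also have "\<dots> = (\<Sum>i\<le>j. E $$ (p, i) * x $ i)"
      using j by (intro sum.mono_neutral_cong_right) auto
    also have "\<dots> = (\<Sum>i\<le>j. \<Sum>l<s. E' $$ (p, l) * (y i $ l * x $ i))"
      by (intro sum.cong refl) (simp add: Ep sum_distrib_right mult.assoc)
    also have "\<dots> = (\<Sum>l<s. E' $$ (p, l) * (\<Sum>i\<le>j. y i $ l * x $ i))"
      by (subst sum.swap) (simp add: sum_distrib_left)
    also have "\<dots> = 0" by (simp add: yx)
    finally show "(E *\<^sub>v x') $ p = 0\<^sub>v n $ p" using p by simp
  qed (use E in simp)
  then have x'0: "x' = 0\<^sub>v r" using E(1,2) by (auto simp: inj_mat_def x'_def)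
  have "x $ i = 0" if "i \<le> j" for i
    using arg_cong[OF x'0, of "\<lambda>v. v $ i"] that j by (simp add: x'_def)
  then have "x = 0\<^sub>v (Suc j)" using x(1) by (intro eq_vecI) auto
  then show False using x(3) by simp
qed

section \<open>Minors\<close>

lemma submatrix_rows:
  assumes A: "A \<in> carrier_mat n r" and S: "S \<subseteq> {..<n}"
  shows "submatrix A S UNIV = mat (card S) r (\<lambda>(i, j). A $$ (pick S i, j))"
proof -
  have "{i. i < n \<and> i \<in> S} = S" using S by auto
  then show ?thesis using A by (simp add: submatrix_def pick_UNIV)
qed

lemma pick_lt:
  assumes "S \<subseteq> {..<n}" "i < card S"
  shows "pick S i < n"
  using pick_in_set_le[OF assms(2)] assms(1) by auto

lemma det_submatrix_mult:
  assumes A: "A \<in> carrier_mat n r" and U: "U \<in> carrier_mat r r" and S: "S \<in> minor_index n r"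
  shows "det (submatrix (A * U) S UNIV) = det (submatrix A S UNIV) * det U"
proof -
  have Sn: "S \<subseteq> {..<n}" and cS: "card S = r" using S by (auto simp: minor_index_def)
  have AU: "A * U \<in> carrier_mat n r" using A U by simp
  have "submatrix (A * U) S UNIV = submatrix A S UNIV * U"
  proof (intro eq_matI)
    fix i j assume "i < dim_row (submatrix A S UNIV * U)" "j < dim_col (submatrix A S UNIV * U)"
    then have ij: "i < r" "j < r" using submatrix_rows[OF A Sn] cS U by auto
    then have "pick S i < n" using pick_lt[OF Sn] cS by simp
    then show "submatrix (A * U) S UNIV $$ (i, j) = (submatrix A S UNIV * U) $$ (i, j)"
      using ij A U cS unfolding submatrix_rows[OF A Sn] submatrix_rows[OF AU Sn]
      by (simp add: scalar_prod_def)
  qed (use submatrix_rows[OF A Sn] submatrix_rows[OF AU Sn] cS U in simp_all)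
  moreover have "submatrix A S UNIV \<in> carrier_mat r r" using submatrix_rows[OF A Sn] cS by simp
  ultimately show ?thesis using det_mult U by metis
qed

lemma const_poly_hom: "comm_ring_hom (\<lambda>c::'a::comm_ring_1. [:c:])"
  by unfold_locales (auto simp: one_pCons)

lemma map_const_mult:
  assumes "A \<in> carrier_mat n r" "B \<in> carrier_mat r s"
  shows "map_mat (\<lambda>c. [:c:]) (A * B) = map_mat (\<lambda>c::'a::comm_ring_1. [:c:]) A * map_mat (\<lambda>c. [:c:]) B"
  using semiring_hom.mat_hom_mult[OF _ assms, of "\<lambda>c::'a. [:c:]"] const_poly_hom
  by (simp add: comm_ring_hom_def ring_hom_def)

lemma minor_twisted_columns:
  assumes E: "E \<in> carrier_mat n r" and a: "length a = r" and S: "S \<in> minor_index n r"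
  shows "minor S (twisted_columns E a) = monom (det (submatrix E S UNIV)) (sum_list a)"
proof -
  have Sn: "S \<subseteq> {..<n}" and cS: "card S = r" using S by (auto simp: minor_index_def)
  let ?E = "map_mat (\<lambda>c. [:c:]) E"
  \<comment> \<open>Twisting is right multiplication by this diagonal matrix, so its determinant
    splits off from every minor.\<close>
  define D where "D = mat r r (\<lambda>(i, j). if i = j then monom (1::complex) (a ! j) else 0)"
  have D: "D \<in> carrier_mat r r" by (simp add: D_def)
  have "twisted_columns E a = ?E * D"
  proof (intro eq_matI)
    fix i j assume "i < dim_row (?E * D)" "j < dim_col (?E * D)"
    then have ij: "i < n" "j < r" using E D by auto
    have "(?E * D) $$ (i, j) = (\<Sum>k<r. [:E $$ (i, k):] * (if k = j then monom 1 (a ! j) else 0))"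
      using ij E by (simp add: D_def scalar_prod_def atLeast0LessThan)
    also have "\<dots> = [:E $$ (i, j):] * monom 1 (a ! j)"
      using ij by (simp add: if_distrib[of "\<lambda>x. _ * x"] sum.delta cong: if_cong)
    also have "\<dots> = monom (E $$ (i, j)) (a ! j)" by (simp add: smult_monom)
    finally show "twisted_columns E a $$ (i, j) = (?E * D) $$ (i, j)"
      using ij E by (simp add: twisted_columns_def)
  qed (use E D in \<open>simp_all add: twisted_columns_def\<close>)
  moreover have "det D = monom 1 (sum_list a)"
  proof -
    have "diag_mat D = map (\<lambda>k. monom 1 k) a"
      using a by (intro nth_equalityI) (auto simp: diag_mat_def D_def)
    moreover have "prod_list (map (\<lambda>k. monom (1::complex) k) a) = monom 1 (sum_list a)"
      by (induction a) (auto simp: mult_monom one_pCons monom_0)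
    moreover have "upper_triangular D" by (auto simp: upper_triangular_def D_def)
    ultimately show ?thesis using det_upper_triangular[OF _ D] by simp
  qed
  moreover have "det (submatrix ?E S UNIV) = [:det (submatrix E S UNIV):]"
  proof -
    have Ec: "?E \<in> carrier_mat n r" using E by simp
    have "submatrix ?E S UNIV = map_mat (\<lambda>c. [:c:]) (submatrix E S UNIV)"
      unfolding submatrix_rows[OF E Sn] submatrix_rows[OF Ec Sn]
      using E pick_lt[OF Sn] by (intro eq_matI) auto
    then show ?thesis using comm_ring_hom.hom_det[OF const_poly_hom] by metis
  qed
  ultimately show ?thesis
    using det_submatrix_mult[OF _ D S, of ?E] E by (simp add: minor_def smult_monom)
qed

text \<open>A smallest set of rows that still determines the vector has r elements.\<close>

lemma inj_mat_nonzero_minor: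
  fixes E :: "'a::field mat"
  assumes E: "E \<in> carrier_mat n r" and inj: "inj_mat E"
  shows "\<exists>S\<in>minor_index n r. det (submatrix E S UNIV) \<noteq> 0"
proof -
  define Q where "Q S \<longleftrightarrow> S \<subseteq> {..<n} \<and> (\<forall>x\<in>carrier_vec r. (\<forall>i\<in>S. row E i \<bullet> x = 0) \<longrightarrow> x = 0\<^sub>v r)" for S
  have "Q {..<n}"
    unfolding Q_def
  proof (intro conjI ballI impI)
    fix x assume x: "x \<in> carrier_vec r" "\<forall>i\<in>{..<n}. row E i \<bullet> x = 0"
    then have "E *\<^sub>v x = 0\<^sub>v n" using E by (intro eq_vecI) auto
    then show "x = 0\<^sub>v r" using inj x(1) E by (auto simp: inj_mat_def)
  qed simp
  then obtain S where S: "Q S" and min: "\<And>S'. Q S' \<Longrightarrow> card S \<le> card S'"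
    using ex_has_least_nat[of Q "{..<n}" card] by blast
  then have Sn: "S \<subseteq> {..<n}" and det_S: "\<And>x. x \<in> carrier_vec r \<Longrightarrow> \<forall>i\<in>S. row E i \<bullet> x = 0 \<Longrightarrow> x = 0\<^sub>v r"
    by (auto simp: Q_def)
  have fin: "finite S" using Sn finite_subset by auto
  let ?A = "submatrix E S UNIV"
  have A: "?A \<in> carrier_mat (card S) r" using submatrix_rows[OF E Sn] by simp
  have row_A: "row ?A t = row E (pick S t)" if "t < card S" for t
    unfolding submatrix_rows[OF E Sn] using that E pick_lt[OF Sn that] by (intro eq_vecI) auto
  have surj: "\<exists>t<card S. pick S t = i" if "i \<in> S" for i
  proof -
    have "{a \<in> S. a < i} \<subset> S" using that by auto
    then show ?thesis using psubset_card_mono[OF fin] pick_card_in_set[OF that] by blast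
  qed
  have inj_A: "inj_mat ?A"
    unfolding inj_mat_def
  proof (intro ballI impI)
    fix x assume x: "x \<in> carrier_vec (dim_col ?A)" "?A *\<^sub>v x = 0\<^sub>v (dim_row ?A)"
    have "row E (pick S t) \<bullet> x = 0" if "t < card S" for t
      using arg_cong[OF x(2), of "\<lambda>v. v $ t"] that A row_A[OF that] by simp
    then have "\<forall>i\<in>S. row E i \<bullet> x = 0" using surj by metis
    then show "x = 0\<^sub>v (dim_col ?A)" using det_S x(1) A by simp
  qed
  \<comment> \<open>More than r rows satisfy a linear relation, which expresses one row
    \<open>t0\<close> through the others; dropping it preserves \<open>Q\<close> and contradicts
    minimality.\<close>
  have "\<not> r < card S"
  proof
    assume lt: "r < card S"
    have At: "transpose_mat ?A \<in> carrier_mat r (card S)" using A by simp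
    have "\<not> inj_mat (transpose_mat ?A)" using inj_mat_le[OF At] lt by auto
    then obtain y where y: "y \<in> carrier_vec (card S)" "transpose_mat ?A *\<^sub>v y = 0\<^sub>v r"
      "y \<noteq> 0\<^sub>v (card S)" using At A by (auto simp: inj_mat_def)
    then obtain t0 where t0: "t0 < card S" "y $ t0 \<noteq> 0"
      by (metis carrier_vecD eq_vecI index_zero_vec)
    have ysum: "(\<Sum>t<card S. y $ t * E $$ (pick S t, j)) = 0" if j: "j < r" for j
    proof -
      have "(\<Sum>t<card S. y $ t * E $$ (pick S t, j)) = (transpose_mat ?A *\<^sub>v y) $ j"
        using j A y(1) unfolding submatrix_rows[OF E Sn]
        by (simp add: scalar_prod_def atLeast0LessThan mult.commute)
      then show ?thesis using y(2) j by simp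
    qed
    have "Q (S - {pick S t0})"
      unfolding Q_def
    proof (intro conjI ballI impI)
      fix x assume x: "x \<in> carrier_vec r" "\<forall>i\<in>S - {pick S t0}. row E i \<bullet> x = 0"
      have row_x: "row E (pick S t) \<bullet> x = (\<Sum>j<r. E $$ (pick S t, j) * x $ j)" if "t < card S" for t
        using E x(1) pick_lt[OF Sn that] by (simp add: scalar_prod_def atLeast0LessThan)
      have other: "row E (pick S t) \<bullet> x = 0" if "t < card S" "t \<noteq> t0" for t
      proof -
        have "pick S t \<noteq> pick S t0" using that t0(1) card_pick_le by metis
        then show ?thesis using x(2) pick_in_set_le[OF that(1)] by simp
      qed
      have "(\<Sum>t<card S. y $ t * (row E (pick S t) \<bullet> x))
          = (\<Sum>t<card S. \<Sum>j<r. x $ j * (y $ t * E $$ (pick S t, j)))"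
        by (intro sum.cong refl) (simp add: row_x sum_distrib_left mult.commute mult.left_commute)
      also have "\<dots> = (\<Sum>j<r. x $ j * (\<Sum>t<card S. y $ t * E $$ (pick S t, j)))"
        by (subst sum.swap) (simp add: sum_distrib_left)
      also have "\<dots> = 0" by (simp add: ysum)
      also have "(\<Sum>t<card S. y $ t * (row E (pick S t) \<bullet> x)) = y $ t0 * (row E (pick S t0) \<bullet> x)"
        using t0(1) other by (subst sum.remove[of _ t0]) auto
      finally have "row E (pick S t0) \<bullet> x = 0" using t0(2) by simp
      then have "\<forall>i\<in>S. row E i \<bullet> x = 0" using x(2) by blast
      then show "x = 0\<^sub>v r" using det_S x(1) by blast
    qed (use Sn in auto)
    from min[OF this] have "card S \<le> card S - 1"
      unfolding card_Diff_singleton[OF pick_in_set_le[OF t0(1)]] .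
    then show False using lt by simp
  qed
  then have cS: "card S = r" using inj_mat_le[OF A inj_A] by simp
  have Ar: "?A \<in> carrier_mat r r" using A cS by simp
  have "det ?A \<noteq> 0"
    using det_0_iff_vec_prod_zero[OF Ar] inj_A Ar by (auto simp: inj_mat_def)
  moreover have "S \<in> minor_index n r" using Sn cS by (simp add: minor_index_def)
  ultimately show ?thesis by blast
qed

text \<open>Multiplication by the variable removes the exceptional point 0. This turns identities of
  values over the overlap into polynomial identities.\<close>

lemma poly_eq_nonzero:
  fixes p q :: "complex poly"
  assumes "\<And>x. x \<noteq> 0 \<Longrightarrow> poly p x = poly q x"
  shows "p = q"
proof -
  have "poly (p * [:0, 1:]) x = poly (q * [:0, 1:]) x" for x using assms[of x] by (cases "x = 0") auto
  then have "p * [:0, 1:] = q * [:0, 1:]" using poly_eq_poly_eq_iff by blast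
  then show ?thesis by simp
qed

text \<open>Since the degree is prescribed, the restriction to z1 = 1 determines all coefficients;
  so agreement with the minors in the z chart pins down the form.\<close>

lemma binary_form_eq_power:
  assumes f: "f \<in> binary_forms d" and eq: "\<And>x. f x 1 = k * x ^ d"
  shows "f = (\<lambda>z0 z1. k * z0 ^ d)"
proof -
  obtain c where c: "f = (\<lambda>z0 z1. \<Sum>k\<le>d. c k * z0 ^ k * z1 ^ (d - k))"
    using f by (auto simp: binary_forms_def)
  have "(\<Sum>i\<le>d. c i * x ^ i) = (\<Sum>i\<le>d. (if i = d then k else 0) * x ^ i)" for x
  proof -
    have "(\<Sum>i\<le>d. (if i = d then k else 0) * x ^ i) = (\<Sum>i\<le>d. if i = d then k * x ^ d else 0)"
      by (intro sum.cong) auto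
    then show ?thesis using eq[of x] unfolding c by simp
  qed
  then have "\<forall>i\<le>d. c i = (if i = d then k else 0)"
    by (rule polyfun_eq_coeffs[THEN iffD1, OF allI])
  then have "f z0 z1 = (\<Sum>i\<le>d. (if i = d then k * z0 ^ d else 0))" for z0 z1
    unfolding c by (intro sum.cong) auto
  then have "f z0 z1 = k * z0 ^ d" for z0 z1 by simp
  then show ?thesis by blast
qed

lemma power_in_binary_forms: "(\<lambda>z0 z1. z0 ^ d * k) \<in> binary_forms d"
proof -
  have "z0 ^ d * k = (\<Sum>i\<le>d. (if i = d then k else 0) * z0 ^ i * z1 ^ (d - i))"
    for z0 z1 :: complex
  proof -
    have "(\<Sum>i\<le>d. (if i = d then k else 0) * z0 ^ i * z1 ^ (d - i))
        = (\<Sum>i\<le>d. if i = d then z0 ^ d * k else 0)"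
      by (intro sum.cong) auto
    then show ?thesis by simp
  qed
  then have "(\<lambda>z0 z1. z0 ^ d * k) = (\<lambda>z0 z1. \<Sum>i\<le>d. (if i = d then k else 0) * z0 ^ i * z1 ^ (d - i))"
    by (intro ext)
  then show ?thesis
    unfolding binary_forms_def by (intro CollectI exI[of _ "\<lambda>i. if i = d then k else 0"])
qed

text \<open>The determinant of the transition matrix is a unit of C[z], hence a nonzero constant,
  and it is common to all minors.\<close>

lemma minor_basis_change:
  fixes T G :: "complex poly mat"
  assumes "free_basis n r T M" "free_basis n r G M"
  shows "\<exists>u. u \<noteq> 0 \<and> (\<forall>S\<in>minor_index n r. minor S G = Polynomial.smult u (minor S T))"
proof -
  obtain U where U: "U \<in> carrier_mat r r" "G = T * U" "det U dvd 1"
    using free_basis_unique[OF assms] by blast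
  then obtain u where u: "det U = [:u:]" "u \<noteq> 0"
    by (metis is_unit_polyE dvd_field_iff poly_0_coeff_0 is_unit_pCons_iff)
  have T: "T \<in> carrier_mat n r" using assms by (simp add: free_basis_def)
  have "minor S G = Polynomial.smult u (minor S T)" if "S \<in> minor_index n r" for S
    unfolding minor_def U(2) det_submatrix_mult[OF T U(1) that] u(1) by simp
  then show ?thesis using u by blast
qed

section \<open>The map \<open>psi\<close> on invariant sheaves\<close>

lemma psi_component_discrete_data:
  assumes data: "discrete_data n V a (replicate r 0)" and r: "length a = r"
  shows "\<exists>v\<in>ext_power n r. v \<noteq> (\<lambda>S. 0) \<and>
    psi_component n r (sum_list a) V = proj_point (\<lambda>S z0 z1. z0 ^ sum_list a * v S)"
proof -
  let ?d = "sum_list a"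
  obtain W E E' where E: "free_basis n r E W" and E': "free_basis n r E' W"
    and T: "free_basis n r (twisted_columns E a) (fst V)"
    and T': "free_basis n r (twisted_columns E' (replicate r 0)) (snd V)"
    using data r by (auto simp: discrete_data_def)
  have Ec: "E \<in> carrier_mat n r" "inj_mat E" and E'c: "E' \<in> carrier_mat n r"
    using E E' by (auto simp: free_basis_iff)
  define v where "v S = (if S \<in> minor_index n r then det (submatrix E S UNIV) else 0)" for S
  obtain U where U: "U \<in> carrier_mat r r" "E' = E * U" "det U dvd 1"
    using free_basis_unique[OF E E'] by blast
  define e where "e = det U"
  have e: "e \<noteq> 0" using U(3) by (auto simp: e_def)
  have vE': "det (submatrix E' S UNIV) = v S * e" if "S \<in> minor_index n r" for S
    using det_submatrix_mult[OF Ec(1) U(1) that] that by (simp add: U(2) v_def e_def)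
  have minor_T: "minor S (twisted_columns E a) = monom (v S) ?d" if "S \<in> minor_index n r" for S
    using minor_twisted_columns[OF Ec(1) r that] that by (simp add: v_def)
  have minor_T': "minor S (twisted_columns E' (replicate r 0)) = [:v S * e:]"
    if "S \<in> minor_index n r" for S
    using minor_twisted_columns[OF E'c _ that, of "replicate r 0"] vE'[OF that]
    by (simp add: sum_list_replicate monom_0)
  have "psi_component n r ?d V = proj_point (\<lambda>S z0 z1. z0 ^ ?d * v S)"
  proof (intro subset_antisym subsetI)
    fix f assume "f \<in> psi_component n r ?d V"
    then obtain G H c c' where f: "f \<in> form_vecs n r ?d"
      and G: "free_basis n r G (fst V)" and c: "c \<noteq> 0"
      and fG: "\<forall>S\<in>minor_index n r. \<forall>x. f S x 1 = c * poly (minor S G) x"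
      unfolding psi_component_def by blast
    obtain u where u: "u \<noteq> 0" "\<forall>S\<in>minor_index n r. minor S G = Polynomial.smult u (monom (v S) ?d)"
      using minor_basis_change[OF T G] minor_T by auto
    have "f S = (\<lambda>z0 z1. c * u * (z0 ^ ?d * v S))" for S
    proof (cases "S \<in> minor_index n r")
      case True
      have "f S = (\<lambda>z0 z1. (c * u * v S) * z0 ^ ?d)"
        using f True fG u by (intro binary_form_eq_power) (auto simp: form_vecs_def poly_monom)
      then show ?thesis by (simp add: ac_simps)
    next
      case False
      then show ?thesis using f by (simp add: form_vecs_def v_def)
    qed
    then have "f = (\<lambda>S z0 z1. c * u * (z0 ^ ?d * v S))" by auto
    moreover have "c * u \<noteq> 0" using c u by simp
    ultimately show "f \<in> proj_point (\<lambda>S z0 z1. z0 ^ ?d * v S)"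
      unfolding proj_point_def by blast
  next
    fix f assume "f \<in> proj_point (\<lambda>S z0 z1. z0 ^ ?d * v S)"
    then obtain c where c: "c \<noteq> 0" "f = (\<lambda>S z0 z1. c * (z0 ^ ?d * v S))"
      by (auto simp: proj_point_def)
    have "f S \<in> binary_forms ?d" for S
      using power_in_binary_forms[of ?d "c * v S"] by (simp add: c(2) mult.left_commute)
    moreover have "f S = (\<lambda>z0 z1. 0)" if "S \<notin> minor_index n r" for S
      using that by (simp add: c(2) v_def)
    ultimately have "f \<in> form_vecs n r ?d" by (simp add: form_vecs_def)
    \<comment> \<open>At infinity the minors are the constants \<open>v S * e\<close>, where
      \<open>e\<close> compares the bases \<open>E'\<close> and \<open>E\<close>; hence the second
      unit has to be \<open>c / e\<close>.\<close>
    moreover have "\<forall>S\<in>minor_index n r. \<forall>x.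
        f S x 1 = c * poly (minor S (twisted_columns E a)) x \<and>
        f S 1 x = (c / e) * poly (minor S (twisted_columns E' (replicate r 0))) x"
      using e by (auto simp: minor_T minor_T' c(2) poly_monom)
    moreover have "c / e \<noteq> 0" using c e by simp
    ultimately show "f \<in> psi_component n r ?d V"
      using T T' c(1) unfolding psi_component_def by blast
  qed
  moreover have "v \<in> ext_power n r" by (simp add: ext_power_def v_def)
  moreover have "v \<noteq> (\<lambda>S. 0)"
    using inj_mat_nonzero_minor[OF Ec] by (auto simp: v_def fun_eq_iff)
  ultimately show ?thesis by blast
qed

text \<open>Used in both directions, this makes the charts see the same subspace of C^n: over the
  overlap z^k v is a unit times \<open>v\<close>, and clearing the negative power puts some multiple
  of \<open>v\<close> by a power of the coordinate into the other module.\<close>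

lemma localization_constant_vectors:
  assumes M': "vec_submodule n M'" and loc: "\<forall>s\<in>M. in_localization M' (\<lambda>x. ev s (1 / x))"
    and v: "v \<in> carrier_vec n" "monom_vec k v \<in> M"
  shows "\<exists>l. monom_vec l v \<in> M'"
proof -
  obtain N t where t: "t \<in> M'" and eq: "\<And>x. x \<noteq> 0 \<Longrightarrow> ev t x = x ^ N \<cdot>\<^sub>v ev (monom_vec k v) (1 / x)"
    using loc v(2) by (auto simp: in_localization_def)
  have tn: "t \<in> carrier_vec n" using M' t by (auto simp: vec_submodule_def)
  have "monom 1 k \<cdot>\<^sub>v t = monom_vec N v"
  proof (intro eq_vecI)
    fix i assume "i < dim_vec (monom_vec N v)"
    then have i: "i < n" using v by (simp add: monom_vec_def)
    have "poly (monom 1 k * t $ i) x = poly (monom (v $ i) N) x" if x: "x \<noteq> 0" for x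
    proof -
      have "poly (t $ i) x = ev t x $ i" using i tn by (simp add: ev_def)
      also have "\<dots> = x ^ N * (v $ i * (1 / x) ^ k)"
        using i v by (simp add: eq[OF x]) (simp add: ev_def monom_vec_def poly_monom)
      finally show ?thesis using x by (simp add: poly_monom power_divide)
    qed
    then have "monom 1 k * t $ i = monom (v $ i) N" by (rule poly_eq_nonzero)
    then show "(monom 1 k \<cdot>\<^sub>v t) $ i = monom_vec N v $ i"
      using i tn v by (simp add: monom_vec_def)
  qed (use tn v in \<open>simp add: monom_vec_def\<close>)
  moreover have "monom 1 k \<cdot>\<^sub>v t \<in> M'" using M' t by (simp add: vec_submodule_def)
  ultimately show ?thesis by auto
qed

lemma discrete_data_of_psi_component:
  assumes V: "V \<in> subsheaves n" and rot: "\<And>\<theta>. rotate_sheaf \<theta> V = V"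
    and v: "v \<in> ext_power n r" "v \<noteq> (\<lambda>S. 0)"
    and psi: "psi_component n r d V = proj_point (\<lambda>S z0 z1. z0 ^ d * v S)"
  shows "\<exists>a. length a = r \<and> sum_list a = d \<and> discrete_data n V a (replicate r 0)"
proof -
  obtain M0 Minf where Veq: "V = (M0, Minf)" by (cases V)
  have M0: "vec_submodule n M0" and Minf: "vec_submodule n Minf"
    and loc: "\<forall>s\<in>M0. in_localization Minf (\<lambda>w. ev s (1 / w))"
    and loc': "\<forall>t\<in>Minf. in_localization M0 (\<lambda>z. ev t (1 / z))"
    using V submodule_imp_vec_submodule unfolding subsheaves_def Veq by blast+
  have rot0: "scale_var (cis (- \<theta>)) ` M0 = M0" and rotinf: "scale_var (cis \<theta>) ` Minf = Minf" for \<theta>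
    using rot[of \<theta>] by (auto simp: rotate_sheaf_def Veq)
  have r0: "scale_var (cis \<theta>) s \<in> M0" if "s \<in> M0" for \<theta> s
    using rot0[of "- \<theta>"] that by (metis image_eqI minus_minus)
  have rinf: "scale_var (cis \<theta>) s \<in> Minf" if "s \<in> Minf" for \<theta> s
    using rotinf[of \<theta>] that by blast
  obtain E a where a: "sorted a" and E: "free_basis n (length a) E {v \<in> carrier_vec n. \<exists>k. monom_vec k v \<in> M0}"
    and T: "free_basis n (length a) (twisted_columns E a) M0"
    using graded_module_free_basis[OF M0 rotation_invariant_graded[OF M0 r0]] by blast
  obtain E' b where b: "sorted b" and E': "free_basis n (length b) E' {v \<in> carrier_vec n. \<exists>k. monom_vec k v \<in> Minf}"
    and T': "free_basis n (length b) (twisted_columns E' b) Minf"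
    using graded_module_free_basis[OF Minf rotation_invariant_graded[OF Minf rinf]] by blast
  have W: "{v \<in> carrier_vec n. \<exists>k. monom_vec k v \<in> M0} = {v \<in> carrier_vec n. \<exists>k. monom_vec k v \<in> Minf}"
    using localization_constant_vectors[OF Minf loc] localization_constant_vectors[OF M0 loc'] by blast
  let ?f = "\<lambda>S z0 z1. z0 ^ d * v S"
  \<comment> \<open>The form belongs to its own class, so the equation for
    \<open>psi_component\<close> hands over bases \<open>G\<close> and \<open>H\<close> with r
    columns; these fix the lengths of \<open>a\<close> and \<open>b\<close>.\<close>
  have "?f \<in> proj_point ?f" unfolding proj_point_def by (auto intro!: exI[of _ 1])
  then have "?f \<in> psi_component n r d V" using psi by simp
  then obtain G H c c' where G: "free_basis n r G M0" and H: "free_basis n r H Minf"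
    and f: "\<forall>S\<in>minor_index n r. \<forall>x. ?f S x 1 = c * poly (minor S G) x \<and>
      ?f S 1 x = c' * poly (minor S H) x"
    unfolding psi_component_def Veq fst_conv snd_conv by blast
  have fG: "x ^ d * v S = c * poly (minor S G) x" and fH: "v S = c' * poly (minor S H) x"
    if "S \<in> minor_index n r" for S x
    using f that by auto
  have la: "length a = r" and lb: "length b = r"
    using free_basis_unique[OF G T] free_basis_unique[OF H T'] by auto
  obtain S where vS: "v S \<noteq> 0" using v(2) by auto
  then have S: "S \<in> minor_index n r" using v(1) by (auto simp: ext_power_def)
  have Ec: "E \<in> carrier_mat n r" "E' \<in> carrier_mat n r"
    using E E' la lb by (auto simp: free_basis_def)
  obtain u where u: "minor S G = Polynomial.smult u (monom (det (submatrix E S UNIV)) (sum_list a))"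
    using minor_basis_change[OF T[unfolded la] G] S minor_twisted_columns[OF Ec(1) la S] by auto
  obtain u' where u': "minor S H = Polynomial.smult u' (monom (det (submatrix E' S UNIV)) (sum_list b))"
    using minor_basis_change[OF T'[unfolded lb] H] S minor_twisted_columns[OF Ec(2) lb S] by auto
  \<comment> \<open>At w = 0 the left side is nonzero, whereas a positive sum of exponents would
    make the right side vanish.\<close>
  have "v S = c' * (u' * (det (submatrix E' S UNIV) * 0 ^ sum_list b))"
    using fH[OF S, of 0] by (simp add: u' poly_monom)
  then have "sum_list b = 0" using vS by (cases "sum_list b") auto
  then have b0: "b = replicate r 0" using lb by (intro replicate_eqI) auto
  define k where "k = c * u * det (submatrix E S UNIV)"
  have eq: "x ^ d * v S = k * x ^ sum_list a" for x
    using fG[OF S, of x] by (simp add: u poly_monom k_def)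
  \<comment> \<open>Two points suffice: x = 1 identifies the constant, and x = 2 compares the powers
    through their norms.\<close>
  have "k = v S" using eq[of 1] by simp
  then have "(2::complex) ^ d = 2 ^ sum_list a" using eq[of 2] vS by simp
  then have "norm ((2::complex) ^ d) = norm ((2::complex) ^ sum_list a)" by simp
  then have "sum_list a = d" by (simp add: norm_power)
  moreover have "discrete_data n V a (replicate r 0)"
    unfolding discrete_data_def Veq fst_conv snd_conv
    using a b E E' T T' W la lb unfolding b0 by auto
  ultimately show ?thesis using la by blast
qed

section \<open>Uniqueness of the exponents\<close>

lemma discrete_data_antimono:
  assumes V: "discrete_data n V a b" and V': "discrete_data n V' a' b'"
    and le: "fst V \<subseteq> fst V'" and j: "j < length a"
  shows "j < length a' \<and> a' ! j \<le> a ! j"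
proof -
  obtain W E where E: "sorted a" "free_basis n (length a) E W"
    "free_basis n (length a) (twisted_columns E a) (fst V)"
    using V by (auto simp: discrete_data_def)
  obtain W' E' where E': "sorted a'" "free_basis n (length a') E' W'"
    "free_basis n (length a') (twisted_columns E' a') (fst V')"
    using V' by (auto simp: discrete_data_def)
  show ?thesis
    using twisted_exponents_antimono[OF le _ _ E(3) refl _ E'(3) refl E(1) E'(1) j] E(2) E'(2)
    by (auto simp: free_basis_iff)
qed

text \<open>The comparison along an inclusion is applied to \<open>V\<close> inside itself, in both
  directions. Disjointness of the fixed components comes from here.\<close>

lemma discrete_data_unique:
  assumes "discrete_data n V a b" "discrete_data n V a' b'"
  shows "a = a'"
proof (rule nth_equalityI)
  note le = discrete_data_antimono[OF assms subset_refl]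
    discrete_data_antimono[OF assms(2) assms(1) subset_refl]
  show "length a = length a'" using le by (metis linorder_neqE_nat less_irrefl)
  show "a ! j = a' ! j" if "j < length a" for j
    using le(1)[OF that] le(2)[of j] by auto
qed

section \<open>Hilbert polynomials\<close>

lemma ev_const_mult:
  assumes "B \<in> carrier_mat n r" "y \<in> carrier_vec r"
  shows "ev (map_mat (\<lambda>c. [:c:]) B *\<^sub>v y) x = B *\<^sub>v ev y x"
  using assms by (intro eq_vecI) (auto simp: ev_def scalar_prod_def poly_sum)

lemma ev_index: "j < dim_vec y \<Longrightarrow> ev y x $ j = poly (y $ j) x"
  by (simp add: ev_def)

lemma ev_carrier: "y \<in> carrier_vec n \<Longrightarrow> ev y x \<in> carrier_vec n"
  by (simp add: ev_def)

lemma map_const_inverse: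
  assumes B: "B \<in> carrier_mat n n" and C: "C \<in> carrier_mat n n" and BC: "B * C = 1\<^sub>m n"
  shows "map_mat (\<lambda>c. [:c:]) B * map_mat (\<lambda>c. [:c:]) C = (1\<^sub>m n :: 'a::comm_ring_1 poly mat)"
proof -
  have "map_mat (\<lambda>c. [:c:]) (1\<^sub>m n) = (1\<^sub>m n :: 'a poly mat)"
    by (intro eq_matI) (auto simp: one_pCons)
  then show ?thesis using map_const_mult[OF B C] BC by simp
qed

lemma mult_inverse_mat_vec:
  fixes B :: "'a::comm_ring_1 mat"
  assumes "B \<in> carrier_mat n n" "C \<in> carrier_mat n n" "B * C = 1\<^sub>m n" "y \<in> carrier_vec n"
  shows "B *\<^sub>v (C *\<^sub>v y) = y"
  using assoc_mult_mat_vec[OF assms(1,2,4)] assms(3,4) by simp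

section \<open>Coordinates in which the sheaf splits\<close>

lemma twisted_columns_extend:
  assumes E: "E \<in> carrier_mat n r" and B: "B \<in> carrier_mat n n"
    and BE: "\<forall>i<n. \<forall>j<r. B $$ (i, j) = E $$ (i, j)" and rn: "r \<le> n" and x: "x \<in> carrier_vec r"
  shows "twisted_columns E a *\<^sub>v x
    = map_mat (\<lambda>c. [:c:]) B *\<^sub>v vec n (\<lambda>j. if j < r then monom 1 (a ! j) * x $ j else 0)"
proof (intro eq_vecI)
  let ?y = "vec n (\<lambda>j. if j < r then monom 1 (a ! j) * x $ j else 0)"
  fix i assume "i < dim_vec (map_mat (\<lambda>c. [:c:]) B *\<^sub>v ?y)"
  then have i: "i < n" using B by simp
  have "(map_mat (\<lambda>c. [:c:]) B *\<^sub>v ?y) $ i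
      = (\<Sum>j<n. [:B $$ (i, j):] * (if j < r then monom 1 (a ! j) * x $ j else 0))"
    using i B by (simp add: scalar_prod_def atLeast0LessThan)
  also have "\<dots> = (\<Sum>j<r. monom (E $$ (i, j)) (a ! j) * x $ j)"
  proof (rule sum.mono_neutral_cong_right)
    show "[:B $$ (i, j):] * (if j < r then monom 1 (a ! j) * x $ j else 0)
        = monom (E $$ (i, j)) (a ! j) * x $ j" if "j \<in> {..<r}" for j
      using that BE i by (simp add: smult_monom flip: mult_smult_left)
  qed (use rn in auto)
  also have "\<dots> = (twisted_columns E a *\<^sub>v x) $ i"
    using i E x by (simp add: twisted_columns_def scalar_prod_def atLeast0LessThan)
  finally show "(twisted_columns E a *\<^sub>v x) $ i = (map_mat (\<lambda>c. [:c:]) B *\<^sub>v ?y) $ i" by simp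
qed (use E B in \<open>simp add: twisted_columns_def\<close>)

text \<open>In the coordinates of \<open>B\<close> the module is a direct sum of the ideals
  generated by z^(a_j) for j < r and of zero for the other j, so membership is tested entry by
  entry.\<close>

lemma twisted_span_coordinates:
  assumes T: "free_basis n r (twisted_columns E a) M" and E: "E \<in> carrier_mat n r"
    and B: "B \<in> carrier_mat n n" and C: "C \<in> carrier_mat n n"
    and BC: "B * C = 1\<^sub>m n" and CB: "C * B = 1\<^sub>m n"
    and BE: "\<forall>i<n. \<forall>j<r. B $$ (i, j) = E $$ (i, j)" and rn: "r \<le> n"
    and s: "s \<in> carrier_vec n"
  shows "s \<in> M \<longleftrightarrow> (\<forall>j<r. monom 1 (a ! j) dvd (map_mat (\<lambda>c. [:c:]) C *\<^sub>v s) $ j) \<and>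
    (\<forall>j<n. r \<le> j \<longrightarrow> (map_mat (\<lambda>c. [:c:]) C *\<^sub>v s) $ j = 0)"
    (is "_ \<longleftrightarrow> ?R")
proof
  let ?B = "map_mat (\<lambda>c. [:c:]) B" and ?C = "map_mat (\<lambda>c. [:c:]) C"
  have Bc: "?B \<in> carrier_mat n n" "?C \<in> carrier_mat n n" using B C by auto
  note inv = map_const_inverse[OF B C BC] map_const_inverse[OF C B CB]
  {
    assume "s \<in> M"
    then obtain x where x: "x \<in> carrier_vec r" "s = twisted_columns E a *\<^sub>v x"
      using T by (auto simp: free_basis_iff)
    define y where "y = vec n (\<lambda>j. if j < r then monom 1 (a ! j) * x $ j else 0)"
    have "?C *\<^sub>v s = y"
      unfolding x(2) twisted_columns_extend[OF E B BE rn x(1)] y_def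
      using mult_inverse_mat_vec[OF Bc(2,1) inv(2)] by simp
    then show ?R using rn by (simp add: y_def)
  next
    assume R: ?R
    then have "\<forall>j. \<exists>q. j < r \<longrightarrow> (?C *\<^sub>v s) $ j = monom 1 (a ! j) * q"
      unfolding dvd_def by blast
    then obtain q where q: "\<And>j. j < r \<Longrightarrow> (?C *\<^sub>v s) $ j = monom 1 (a ! j) * q j" by metis
    have "vec n (\<lambda>j. if j < r then monom 1 (a ! j) * vec r q $ j else 0) = ?C *\<^sub>v s"
      using R q C by (intro eq_vecI) (auto simp del: index_mult_mat_vec)
    then have "twisted_columns E a *\<^sub>v vec r q = s"
      using twisted_columns_extend[OF E B BE rn, of "vec r q" a]
        mult_inverse_mat_vec[OF Bc inv(1) s] by simp
    then show "s \<in> M" using T by (auto simp: free_basis_iff)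
  }
qed

text \<open>Reversing \<open>q\<close> clears the denominators in q(1/x), after which degrees can be
  compared. This is the degree bound for sections of O(m).\<close>

lemma transition_coeff_zero:
  fixes p q :: "complex poly"
  assumes eq: "\<And>x. x \<noteq> 0 \<Longrightarrow> poly p x = x ^ m * poly q (1 / x)" and k: "m < k"
  shows "coeff p k = 0"
proof -
  have "poly (monom 1 (degree q) * p) x = poly (monom 1 m * reflect_poly q) x" if "x \<noteq> 0" for x
    using eq[OF that] that by (simp add: poly_monom poly_reflect_poly_nz inverse_eq_divide)
  then have "monom 1 (degree q) * p = monom 1 m * reflect_poly q" by (rule poly_eq_nonzero)
  then have "coeff (monom 1 (degree q) * p) (k + degree q) = coeff (monom 1 m * reflect_poly q) (k + degree q)"
    by simp
  then have "coeff p k = coeff (reflect_poly q) (k + degree q - m)"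
    using k by (simp add: coeff_monom_mult)
  moreover have "degree (reflect_poly q) < k + degree q - m"
    using degree_reflect_poly_le[of q] k by linarith
  ultimately show ?thesis by (simp add: coeff_eq_0)
qed

lemma transition_unique:
  fixes p q q' :: "complex poly"
  assumes "\<And>x. x \<noteq> 0 \<Longrightarrow> poly p x = x ^ m * poly q (1 / x)"
    and "\<And>x. x \<noteq> 0 \<Longrightarrow> poly p x = x ^ m * poly q' (1 / x)"
  shows "q = q'"
proof (rule poly_eq_nonzero)
  fix x :: complex assume x: "x \<noteq> 0"
  then have "(1 / x) ^ m * poly q (1 / (1 / x)) = (1 / x) ^ m * poly q' (1 / (1 / x))"
    using assms[of "1 / x"] by simp
  then show "poly q x = poly q' x" using x by simp
qed

text \<open>Elements of V have zero entries in the directions from r on, so there gluing modulo V is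
  exact gluing, and the entries form a section of O(m).\<close>

lemma quotient_sections_coordinates:
  assumes mem: "\<And>s. s \<in> carrier_vec n \<Longrightarrow> s \<in> fst V \<longleftrightarrow>
      (\<forall>j<r. monom 1 (a ! j) dvd (map_mat (\<lambda>c. [:c:]) C *\<^sub>v s) $ j) \<and>
      (\<forall>j<n. r \<le> j \<longrightarrow> (map_mat (\<lambda>c. [:c:]) C *\<^sub>v s) $ j = 0)"
    and sub: "fst V \<subseteq> carrier_vec n"
    and C: "C \<in> carrier_mat n n" and pq: "(p, q) \<in> quotient_sections n V m"
    and j: "j < n" "r \<le> j" and x: "x \<noteq> 0"
  shows "poly ((map_mat (\<lambda>c. [:c:]) C *\<^sub>v p) $ j) x
    = x ^ m * poly ((map_mat (\<lambda>c. [:c:]) C *\<^sub>v q) $ j) (1 / x)"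
proof -
  let ?C = "map_mat (\<lambda>c. [:c:]) C"
  have p: "p \<in> carrier_vec n" and q: "q \<in> carrier_vec n"
    using pq by (auto simp: quotient_sections_def)
  obtain N s where s: "s \<in> fst V"
    and eq: "\<And>x. x \<noteq> 0 \<Longrightarrow> ev s x = x ^ N \<cdot>\<^sub>v (ev p x - x ^ m \<cdot>\<^sub>v ev q (1 / x))"
    using pq by (auto simp: quotient_sections_def in_localization_def)
  have sn: "s \<in> carrier_vec n" using s sub by blast
  have ep: "ev p x \<in> carrier_vec n" and eq': "ev q (1 / x) \<in> carrier_vec n"
    using ev_carrier p q by auto
  have "0 = ev (?C *\<^sub>v s) x $ j"
    using mem[OF sn] s j C sn by (simp add: ev_index)
  also have "\<dots> = (C *\<^sub>v (x ^ N \<cdot>\<^sub>v (ev p x - x ^ m \<cdot>\<^sub>v ev q (1 / x)))) $ j"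
    by (simp add: ev_const_mult[OF C sn] eq[OF x])
  also have "\<dots> = x ^ N * ((C *\<^sub>v ev p x) $ j - x ^ m * (C *\<^sub>v ev q (1 / x)) $ j)"
  proof -
    have "C *\<^sub>v (x ^ N \<cdot>\<^sub>v (ev p x - x ^ m \<cdot>\<^sub>v ev q (1 / x)))
        = x ^ N \<cdot>\<^sub>v (C *\<^sub>v ev p x - x ^ m \<cdot>\<^sub>v (C *\<^sub>v ev q (1 / x)))"
      using C ep eq' by (simp add: mult_mat_vec[of _ n n] mult_minus_distrib_mat_vec[of _ n n])
    then show ?thesis using C j by simp
  qed
  finally have "(C *\<^sub>v ev p x) $ j = x ^ m * (C *\<^sub>v ev q (1 / x)) $ j" using x by simp
  then have "ev (?C *\<^sub>v p) x $ j = x ^ m * ev (?C *\<^sub>v q) (1 / x) $ j"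
    by (simp only: ev_const_mult[OF C p] ev_const_mult[OF C q])
  then show ?thesis using C j by (simp add: ev_index)
qed

text \<open>In the first r directions the quotient is torsion at 0 and vanishes over the overlap, so
  \<open>y\<close> is unconstrained there; in the other directions the entries must glue as sections
  of O(m).\<close>

lemma quotient_sections_intro:
  assumes mem: "\<And>s. s \<in> carrier_vec n \<Longrightarrow> s \<in> fst V \<longleftrightarrow>
      (\<forall>j<r. monom 1 (a ! j) dvd (map_mat (\<lambda>c. [:c:]) C *\<^sub>v s) $ j) \<and>
      (\<forall>j<n. r \<le> j \<longrightarrow> (map_mat (\<lambda>c. [:c:]) C *\<^sub>v s) $ j = 0)"
    and a: "length a = r" and rn: "r \<le> n"
    and B: "B \<in> carrier_mat n n" and C: "C \<in> carrier_mat n n" and CB: "C * B = 1\<^sub>m n"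
    and y: "y \<in> carrier_vec n" and z: "z \<in> carrier_vec n"
    and low: "\<And>j. j < r \<Longrightarrow> z $ j = 0"
    and high: "\<And>j x. j < n \<Longrightarrow> r \<le> j \<Longrightarrow> x \<noteq> 0 \<Longrightarrow> poly (y $ j) x = x ^ m * poly (z $ j) (1 / x)"
  shows "(map_mat (\<lambda>c. [:c:]) B *\<^sub>v y, map_mat (\<lambda>c. [:c:]) B *\<^sub>v z) \<in> quotient_sections n V m"
proof -
  let ?B = "map_mat (\<lambda>c. [:c:]) B" and ?C = "map_mat (\<lambda>c. [:c:]) C"
  have Bc: "?B \<in> carrier_mat n n" "?C \<in> carrier_mat n n" using B C by auto
  \<comment> \<open>A common bound for the exponents, so that z^N kills the torsion in all r
    directions at once.\<close>
  define N where "N = sum_list a"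
  define t where "t = vec n (\<lambda>j. if j < r then monom 1 N * y $ j else 0)"
  have t: "t \<in> carrier_vec n" by (simp add: t_def)
  have Ct: "?C *\<^sub>v (?B *\<^sub>v t) = t"
    by (rule mult_inverse_mat_vec[OF Bc(2,1) map_const_inverse[OF C B CB] t])
  have "monom 1 (a ! j) dvd t $ j" if j: "j < r" for j
  proof -
    have "a ! j \<le> N" unfolding N_def using j a by (intro member_le_sum_list) auto
    then have "monom 1 N = monom (1::complex) (a ! j) * monom 1 (N - a ! j)"
      by (simp add: mult_monom)
    then show ?thesis using j rn by (simp add: t_def)
  qed
  then have mem_t: "?B *\<^sub>v t \<in> fst V"
    using mem[of "?B *\<^sub>v t"] Bc t rn by (simp add: Ct) (simp add: t_def)
  have "ev (?B *\<^sub>v t) x = x ^ N \<cdot>\<^sub>v (ev (?B *\<^sub>v y) x - x ^ m \<cdot>\<^sub>v ev (?B *\<^sub>v z) (1 / x))"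
    if x: "x \<noteq> 0" for x
  proof -
    have ey: "ev y x \<in> carrier_vec n" and ez: "ev z (1 / x) \<in> carrier_vec n"
      using ev_carrier y z by auto
    have "ev t x = x ^ N \<cdot>\<^sub>v (ev y x - x ^ m \<cdot>\<^sub>v ev z (1 / x))"
      using y z low high[OF _ _ x] rn
      by (intro eq_vecI) (auto simp: t_def ev_def poly_monom)
    then have "B *\<^sub>v ev t x = x ^ N \<cdot>\<^sub>v (B *\<^sub>v ev y x - x ^ m \<cdot>\<^sub>v (B *\<^sub>v ev z (1 / x)))"
      using B ey ez by (simp add: mult_mat_vec[of _ n n] mult_minus_distrib_mat_vec[of _ n n])
    then show ?thesis by (simp only: ev_const_mult[OF B y] ev_const_mult[OF B z] ev_const_mult[OF B t])
  qed
  then have "in_localization (fst V) (\<lambda>x. ev (?B *\<^sub>v y) x - x ^ m \<cdot>\<^sub>v ev (?B *\<^sub>v z) (1 / x))"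
    unfolding in_localization_def using mem_t by blast
  moreover have "?B *\<^sub>v y \<in> carrier_vec n" "?B *\<^sub>v z \<in> carrier_vec n"
    using mult_mat_vec_carrier[OF Bc(1) y] mult_mat_vec_carrier[OF Bc(1) z] .
  ultimately show ?thesis unfolding quotient_sections_def by simp
qed

text \<open>
  In the coordinates of a basis extending the \<open>e\<^sub>j\<close>, a basis of \<open>H\<^sup>0(Q(m))\<close> is given by the pairs
  \<open>(z\<^sup>k e\<^sub>j, 0)\<close> with \<open>j < r\<close>, \<open>k < \<alpha>\<^sub>j\<close> and \<open>(z\<^sup>k e\<^sub>j, w\<^bsup>m-k\<^esup> e\<^sub>j)\<close> with \<open>r \<le> j\<close>, \<open>k \<le> m\<close>.
\<close>

lemma h0_quotient_eq_coordinates: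
  fixes V :: sheaf
  assumes mem: "\<And>s. s \<in> carrier_vec n \<Longrightarrow> s \<in> fst V \<longleftrightarrow>
      (\<forall>j<r. monom 1 (a ! j) dvd (map_mat (\<lambda>c. [:c:]) C *\<^sub>v s) $ j) \<and>
      (\<forall>j<n. r \<le> j \<longrightarrow> (map_mat (\<lambda>c. [:c:]) C *\<^sub>v s) $ j = 0)"
    and mem': "\<And>s. s \<in> carrier_vec n \<Longrightarrow> s \<in> snd V \<longleftrightarrow>
      (\<forall>j<n. r \<le> j \<longrightarrow> (map_mat (\<lambda>c. [:c:]) C *\<^sub>v s) $ j = 0)"
    and sub: "fst V \<subseteq> carrier_vec n" and a: "length a = r" and rn: "r \<le> n"
    and B: "B \<in> carrier_mat n n" and C: "C \<in> carrier_mat n n"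
    and CB: "C * B = 1\<^sub>m n"
  shows "h0_quotient_eq n V m (sum_list a + (n - r) * Suc m)"
proof -
  let ?B = "map_mat (\<lambda>c. [:c:]) B" and ?C = "map_mat (\<lambda>c. [:c:]) C"
  have Bc: "?B \<in> carrier_mat n n" "?C \<in> carrier_mat n n" using B C by auto
  \<comment> \<open>The number of basis elements in direction j. The list \<open>L\<close> of pairs
    (direction, degree) numbers the whole basis by t < K.\<close>
  define c where "c j = (if j < r then a ! j else Suc m)" for j
  obtain L where L: "set L = Sigma {..<n} (\<lambda>j. {..<c j})" "distinct L"
    using finite_distinct_list[of "Sigma {..<n} (\<lambda>j. {..<c j})"] by auto
  define K where "K = length L"
  have "K = (\<Sum>j<n. c j)"
    using distinct_card[OF L(2)] L(1) by (simp add: K_def)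
  also have "\<dots> = (\<Sum>j<r. c j) + (\<Sum>j\<in>{r..<n}. c j)"
    using rn sum.atLeastLessThan_concat[of 0 r n c] by (simp add: atLeast0LessThan)
  also have "(\<Sum>j<r. c j) = sum_list a"
    unfolding sum_list_sum_nth a atLeast0LessThan by (intro sum.cong) (auto simp: c_def)
  also have "(\<Sum>j\<in>{r..<n}. c j) = (\<Sum>j\<in>{r..<n}. Suc m)"
    by (intro sum.cong) (auto simp: c_def)
  also have "sum_list a + \<dots> = sum_list a + (n - r) * Suc m" by simp
  finally have K: "K = sum_list a + (n - r) * Suc m" .
  have L_nth: "fst (L ! t) < n" "snd (L ! t) < c (fst (L ! t))" if "t < K" for t
  proof -
    have "L ! t \<in> Sigma {..<n} (\<lambda>j. {..<c j})"
      using nth_mem[of t L] that unfolding K_def L(1) by blast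
    then show "fst (L ! t) < n" "snd (L ! t) < c (fst (L ! t))"
      by (cases "L ! t"; simp)+
  qed
  \<comment> \<open>The basis in the coordinates of \<open>B\<close>, one column for each entry of
    \<open>L\<close>. In directions below r the w part is 0, because the module at infinity contains
    these directions entirely.\<close>
  define Da where "Da = mat n K (\<lambda>(j, t). if fst (L ! t) = j then monom (1::complex) (snd (L ! t)) else 0)"
  define Db where "Db = mat n K (\<lambda>(j, t). if fst (L ! t) = j \<and> r \<le> j
    then monom (1::complex) (m - snd (L ! t)) else 0)"
  have D: "Da \<in> carrier_mat n K" "Db \<in> carrier_mat n K" by (simp_all add: Da_def Db_def)
  let ?c = "map_vec (\<lambda>c. [:c:])"
  have Da_index: "(Da *\<^sub>v ?c l) $ j = (\<Sum>t<K. if fst (L ! t) = j then monom (l $ t) (snd (L ! t)) else 0)"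
    and Db_index: "(Db *\<^sub>v ?c l) $ j
      = (\<Sum>t<K. if fst (L ! t) = j \<and> r \<le> j then monom (l $ t) (m - snd (L ! t)) else 0)"
    if "l \<in> carrier_vec K" "j < n" for l j
    using that
    by (auto simp: Da_def Db_def scalar_prod_def atLeast0LessThan smult_monom intro!: sum.cong)
  have Da_coeff: "coeff ((Da *\<^sub>v ?c l) $ fst (L ! t)) (snd (L ! t)) = l $ t"
    if l: "l \<in> carrier_vec K" and t: "t < K" for l t
  proof -
    have "coeff ((Da *\<^sub>v ?c l) $ fst (L ! t)) (snd (L ! t))
        = (\<Sum>u<K. if u = t then l $ t else 0)"
      unfolding Da_index[OF l L_nth(1)[OF t]] coeff_sum
    proof (intro sum.cong refl)
      fix u assume "u \<in> {..<K}"
      then have "L ! u = L ! t \<longleftrightarrow> u = t" using L(2) t by (simp add: K_def nth_eq_iff_index_eq)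
      then show "coeff (if fst (L ! u) = fst (L ! t) then monom (l $ u) (snd (L ! u)) else 0) (snd (L ! t))
          = (if u = t then l $ t else 0)"
        by (auto simp: prod_eq_iff)
    qed
    then show ?thesis using t by simp
  qed
  have Da_coeff_0: "coeff ((Da *\<^sub>v ?c l) $ j) k = 0"
    if l: "l \<in> carrier_vec K" and j: "j < n" and k: "c j \<le> k" for l j k
    unfolding Da_index[OF l j] coeff_sum
    using L_nth(2) k by (intro sum.neutral) fastforce
  have trans: "poly ((Da *\<^sub>v ?c l) $ j) x = x ^ m * poly ((Db *\<^sub>v ?c l) $ j) (1 / x)"
    if l: "l \<in> carrier_vec K" and j: "j < n" "r \<le> j" and x: "x \<noteq> 0" for l j x
    unfolding Da_index[OF l j(1)] Db_index[OF l j(1)] poly_sum sum_distrib_left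
  proof (intro sum.cong refl)
    fix t assume "t \<in> {..<K}"
    then have "snd (L ! t) \<le> m" if "fst (L ! t) = j"
      using L_nth(2)[of t] that j by (simp add: c_def)
    then have "x ^ snd (L ! t) = x ^ m * (1 / x) ^ (m - snd (L ! t))" if "fst (L ! t) = j"
      using that x by (simp add: power_one_over power_diff)
    then show "poly (if fst (L ! t) = j then monom (l $ t) (snd (L ! t)) else 0) x
        = x ^ m * poly (if fst (L ! t) = j \<and> r \<le> j then monom (l $ t) (m - snd (L ! t)) else 0) (1 / x)"
      using j by (simp add: poly_monom)
  qed
  have cols: "(col (?B * Da) t, col (?B * Db) t) \<in> quotient_sections n V m" if t: "t < K" for t
  proof -
    let ?l = "unit_vec K t"
    have unit: "?c ?l = unit_vec K t"
      by (intro eq_vecI) (auto simp: unit_vec_def one_pCons)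
    have Dcol: "Da *\<^sub>v ?c ?l = col Da t" "Db *\<^sub>v ?c ?l = col Db t"
      unfolding unit using D t by (auto intro!: eq_vecI)
    have "(?B *\<^sub>v col Da t, ?B *\<^sub>v col Db t) \<in> quotient_sections n V m"
    proof (rule quotient_sections_intro[OF mem a rn B C CB])
      show "col Db t $ j = 0" if "j < r" for j using that rn t by (simp add: Db_def)
      show "poly (col Da t $ j) x = x ^ m * poly (col Db t $ j) (1 / x)"
        if "j < n" "r \<le> j" "x \<noteq> 0" for j x
        using trans[OF _ that, of ?l] unfolding Dcol by simp
    qed (use D in auto)
    then show ?thesis using col_mult2[OF Bc(1) D(1) t] col_mult2[OF Bc(1) D(2) t] by simp
  qed
  have ex1: "\<exists>!l. l \<in> carrier_vec K \<and> p - (?B * Da) *\<^sub>v ?c l \<in> fst V \<and> q - (?B * Db) *\<^sub>v ?c l \<in> snd V"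
    if pq: "(p, q) \<in> quotient_sections n V m" for p q
  proof -
    have p: "p \<in> carrier_vec n" and q: "q \<in> carrier_vec n"
      using pq by (auto simp: quotient_sections_def)
    define y where "y = ?C *\<^sub>v p"
    define z where "z = ?C *\<^sub>v q"
    have yz: "y \<in> carrier_vec n" "z \<in> carrier_vec n"
      unfolding y_def z_def using mult_mat_vec_carrier[OF Bc(2) p] mult_mat_vec_carrier[OF Bc(2) q] .
    have yz_trans: "poly (y $ j) x = x ^ m * poly (z $ j) (1 / x)" if "j < n" "r \<le> j" "x \<noteq> 0" for j x
      unfolding y_def z_def by (rule quotient_sections_coordinates[OF mem sub C pq that])
    have diff_carrier: "v - (?B * X) *\<^sub>v ?c l \<in> carrier_vec n"
      if "v \<in> carrier_vec n" "X \<in> carrier_mat n K" "l \<in> carrier_vec K" for v X l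
    proof -
      have "?c l \<in> carrier_vec K" using that(3) by simp
      then have "(?B * X) *\<^sub>v ?c l \<in> carrier_vec n"
        by (rule mult_mat_vec_carrier[OF mult_carrier_mat[OF Bc(1) that(2)]])
      then show ?thesis by (rule minus_carrier_vec[OF that(1)])
    qed
    have coords: "?C *\<^sub>v (v - (?B * X) *\<^sub>v ?c l) = ?C *\<^sub>v v - X *\<^sub>v ?c l"
      if "v \<in> carrier_vec n" "X \<in> carrier_mat n K" "l \<in> carrier_vec K" for v X l
    proof -
      have Xl: "X *\<^sub>v ?c l \<in> carrier_vec n" using that by simp
      have "(?B * X) *\<^sub>v ?c l = ?B *\<^sub>v (X *\<^sub>v ?c l)"
        using that by (intro assoc_mult_mat_vec[OF Bc(1) that(2)]) simp
      then have "?C *\<^sub>v (v - (?B * X) *\<^sub>v ?c l) = ?C *\<^sub>v v - ?C *\<^sub>v (?B *\<^sub>v (X *\<^sub>v ?c l))"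
        using mult_minus_distrib_mat_vec[OF Bc(2) that(1) mult_mat_vec_carrier[OF Bc(1) Xl]] by simp
      then show ?thesis
        using mult_inverse_mat_vec[OF Bc(2,1) map_const_inverse[OF C B CB] Xl] by simp
    qed
    have mem_a: "p - (?B * Da) *\<^sub>v ?c l \<in> fst V \<longleftrightarrow>
        (\<forall>j<r. \<forall>k<a ! j. coeff (y $ j) k = coeff ((Da *\<^sub>v ?c l) $ j) k) \<and>
        (\<forall>j<n. r \<le> j \<longrightarrow> y $ j = (Da *\<^sub>v ?c l) $ j)"
      if l: "l \<in> carrier_vec K" for l
    proof -
      have "(y - Da *\<^sub>v ?c l) $ j = y $ j - (Da *\<^sub>v ?c l) $ j" if "j < n" for j
        using that D(1) by simp
      then show ?thesis
        unfolding mem[OF diff_carrier[OF p D(1) l]] coords[OF p D(1) l] y_def[symmetric]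
        using rn by (simp add: monom_1_dvd_iff')
    qed
    have mem_b: "q - (?B * Db) *\<^sub>v ?c l \<in> snd V \<longleftrightarrow> (\<forall>j<n. r \<le> j \<longrightarrow> z $ j = (Db *\<^sub>v ?c l) $ j)"
      if l: "l \<in> carrier_vec K" for l
    proof -
      have "(z - Db *\<^sub>v ?c l) $ j = z $ j - (Db *\<^sub>v ?c l) $ j" if "j < n" for j
        using that D(2) by simp
      then show ?thesis
        unfolding mem'[OF diff_carrier[OF q D(2) l]] coords[OF q D(2) l] z_def[symmetric] by simp
    qed
    \<comment> \<open>A forced choice: in direction j, subtracting elements of V leaves the
      coefficients of degree below \<open>c j\<close> unchanged, and the basis has exactly one
      element for each of them.\<close>
    define l where "l = vec K (\<lambda>t. coeff (y $ fst (L ! t)) (snd (L ! t)))"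
    have l: "l \<in> carrier_vec K" by (simp add: l_def)
    have l_coeff: "coeff ((Da *\<^sub>v ?c l) $ j) k = coeff (y $ j) k" if "j < n" "k < c j" for j k
    proof -
      have "(j, k) \<in> set L" using that L(1) by auto
      then obtain t where "t < K" "L ! t = (j, k)" by (auto simp: in_set_conv_nth K_def)
      then show ?thesis using Da_coeff[OF l, of t] by (simp add: l_def)
    qed
    have l_high: "y $ j = (Da *\<^sub>v ?c l) $ j" if j: "j < n" "r \<le> j" for j
    proof (rule poly_eqI)
      fix k
      have cj: "c j = Suc m" using j by (simp add: c_def)
      show "coeff (y $ j) k = coeff ((Da *\<^sub>v ?c l) $ j) k"
      \<comment> \<open>Above degree m both sides vanish: the left by the transition to w, the right
        because the basis stops at degree m.\<close>
      proof (cases "k < c j")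
        case False
        then have "m < k" using cj by simp
        then show ?thesis
          using transition_coeff_zero[OF yz_trans[OF j]] Da_coeff_0[OF l j(1)] False by simp
      qed (use l_coeff[OF j(1)] in simp)
    qed
    have "z $ j = (Db *\<^sub>v ?c l) $ j" if j: "j < n" "r \<le> j" for j
      \<comment> \<open>The z part of a section of O(m) determines its w part, so the match found in
        the z chart carries over.\<close>
      using transition_unique[OF yz_trans[OF j] trans[OF l j, folded l_high[OF j]]] by simp
    then have l_sol: "p - (?B * Da) *\<^sub>v ?c l \<in> fst V" "q - (?B * Db) *\<^sub>v ?c l \<in> snd V"
      unfolding mem_a[OF l] mem_b[OF l] using l_high l_coeff rn by (auto simp: c_def)
    show ?thesis
    proof (intro ex1I[of _ l] conjI l l_sol)
      fix l' assume l': "l' \<in> carrier_vec K \<and> p - (?B * Da) *\<^sub>v ?c l' \<in> fst V \<and> q - (?B * Db) *\<^sub>v ?c l' \<in> snd V"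
      then have l'K: "l' \<in> carrier_vec K" by blast
      have low: "\<forall>j<r. \<forall>k<a ! j. coeff (y $ j) k = coeff ((Da *\<^sub>v ?c l') $ j) k"
        and high: "\<forall>j<n. r \<le> j \<longrightarrow> y $ j = (Da *\<^sub>v ?c l') $ j"
        using l' mem_a[OF l'K] by blast+
      show "l' = l"
      proof (rule eq_vecI)
        fix t assume "t < dim_vec l"
        then have t: "t < K" by (simp add: l_def)
        have "coeff (y $ fst (L ! t)) (snd (L ! t)) = coeff ((Da *\<^sub>v ?c l') $ fst (L ! t)) (snd (L ! t))"
        proof (cases "fst (L ! t) < r")
          case True
          then show ?thesis using low L_nth(2)[OF t] by (simp add: c_def)
        next
          case False
          then show ?thesis using high L_nth(1)[OF t] by simp
        qed
        then show "l' $ t = l $ t" using Da_coeff[OF l'K t] t by (simp add: l_def)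
      qed (use l'K in \<open>simp add: l_def\<close>)
    qed
  qed
  show ?thesis
    unfolding h0_quotient_eq_def K[symmetric]
  proof (rule bexI[OF _ mult_carrier_mat[OF Bc(1) D(1)]], rule bexI[where x = "?B * Db"], rule conjI)
    show "?B * Db \<in> carrier_mat n K" by (rule mult_carrier_mat[OF Bc(1) D(2)])
    show "\<forall>t<K. (col (?B * Da) t, col (?B * Db) t) \<in> quotient_sections n V m"
      using cols by blast
    show "\<forall>(p, q)\<in>quotient_sections n V m. \<exists>!l. l \<in> carrier_vec K \<and>
        p - (?B * Da) *\<^sub>v ?c l \<in> fst V \<and> q - (?B * Db) *\<^sub>v ?c l \<in> snd V"
      by (intro ballI) (clarify, rule ex1)
  qed
qed

lemma discrete_data_h0:
  assumes data: "discrete_data n V a (replicate r 0)" and r: "length a = r"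
  shows "r \<le> n" and "h0_quotient_eq n V m (sum_list a + (n - r) * Suc m)"
proof -
  obtain W E E' where E: "free_basis n r E W" and E': "free_basis n r E' W"
    and T: "free_basis n r (twisted_columns E a) (fst V)"
    and T': "free_basis n r (twisted_columns E' (replicate r 0)) (snd V)"
    using data r by (auto simp: discrete_data_def)
  have Ec: "E \<in> carrier_mat n r" and E'c: "E' \<in> carrier_mat n r"
    using E E' by (auto simp: free_basis_def)
  obtain B C where B: "B \<in> carrier_mat n n" and C: "C \<in> carrier_mat n n"
    and BC: "B * C = 1\<^sub>m n" and CB: "C * B = 1\<^sub>m n"
    and BE: "\<forall>i<n. \<forall>j<r. B $$ (i, j) = E $$ (i, j)" and rn: "r \<le> n"
    using extend_to_invertible[OF E] by blast
  show "r \<le> n" by (rule rn)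
  \<comment> \<open>With \<beta> = 0 every basis of the common subspace generates the module at
    infinity; replacing \<open>E'\<close> by \<open>E\<close> lets one coordinate system serve both
    charts.\<close>
  obtain U where U: "U \<in> carrier_mat r r" "E = E' * U" "det U dvd 1"
    using free_basis_unique[OF E' E] by blast
  then have "det U \<noteq> 0" by auto
  then obtain U' where U': "U' \<in> carrier_mat r r" "U * U' = 1\<^sub>m r" "U' * U = 1\<^sub>m r"
    using det_nonzero_inverse[OF U(1)] by blast
  have const: "twisted_columns F (replicate r 0) = map_mat (\<lambda>c. [:c:]) F" if "F \<in> carrier_mat n r" for F
    using that by (intro eq_matI) (auto simp: twisted_columns_def monom_0)
  have "free_basis n r (map_mat (\<lambda>c. [:c:]) E' * map_mat (\<lambda>c. [:c:]) U) (snd V)"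
    using T' U(1) U'(1) unfolding const[OF E'c]
    by (intro free_basis_mult[OF _ _ _ map_const_inverse[OF U(1) U'(1,2)] map_const_inverse[OF U'(1) U(1) U'(3)]])
      auto
  then have T1: "free_basis n r (twisted_columns E (replicate r 0)) (snd V)"
    unfolding const[OF Ec] map_const_mult[OF E'c U(1), symmetric] U(2)[symmetric] .
  have mem: "s \<in> fst V \<longleftrightarrow>
      (\<forall>j<r. monom 1 (a ! j) dvd (map_mat (\<lambda>c. [:c:]) C *\<^sub>v s) $ j) \<and>
      (\<forall>j<n. r \<le> j \<longrightarrow> (map_mat (\<lambda>c. [:c:]) C *\<^sub>v s) $ j = 0)" if "s \<in> carrier_vec n" for s
    by (rule twisted_span_coordinates[OF T Ec B C BC CB BE rn that])
  have mem': "s \<in> snd V \<longleftrightarrow> (\<forall>j<n. r \<le> j \<longrightarrow> (map_mat (\<lambda>c. [:c:]) C *\<^sub>v s) $ j = 0)"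
    if "s \<in> carrier_vec n" for s
    using twisted_span_coordinates[OF T1 Ec B C BC CB BE rn that]
    by (simp add: monom_0 flip: one_pCons)
  have sub: "fst V \<subseteq> carrier_vec n"
    using free_basis_vec_submodule[OF T] by (simp add: vec_submodule_def)
  show "h0_quotient_eq n V m (sum_list a + (n - r) * Suc m)"
    by (rule h0_quotient_eq_coordinates[OF mem mem' sub r rn B C CB])
qed

lemma discrete_data_hilbert_poly:
  assumes data: "discrete_data n V a (replicate r 0)" and r: "length a = r"
  shows "quotient_hilbert_poly n V [:int (sum_list a) + (int n - int r), int n - int r:]"
proof -
  have "int (n - r) = int n - int r" using discrete_data_h0(1)[OF data r] by (rule of_nat_diff)
  then have "int (sum_list a + (n - r) * Suc m)
      = poly [:int (sum_list a) + (int n - int r), int n - int r:] (int m)" for m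
    unfolding of_nat_add of_nat_mult by (simp add: algebra_simps)
  then show ?thesis
    unfolding quotient_hilbert_poly_def using discrete_data_h0(2)[OF data r]
    by (intro always_eventually allI) blast
qed

section \<open>Fixed components\<close>

text \<open>Row i is taken to be (0, ..., 0, d_i). The rows lengthen strictly, so the last entry of
  row i + 1 stands in a column beyond the end of row i, and row i is compared only with
  zeros.\<close>

lemma index_matrices_nonempty:
  assumes len: "length d = length r" and r: "sorted_wrt (<) r" and pos: "\<forall>i<length r. 0 < r ! i"
  shows "index_matrices r d \<noteq> {}"
proof -
  define A where "A = map (\<lambda>i. replicate (r ! i - 1) 0 @ [d ! i]) [0..<length r]"
  have A: "A ! i = replicate (r ! i - 1) 0 @ [d ! i]" if "i < length r" for i
    using that by (simp add: A_def)
  have "A ! Suc i ! j \<le> A ! i ! j" if i: "Suc i < length r" and j: "j < r ! i" for i j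
  proof -
    have "r ! i < r ! Suc i" using sorted_wrt_nth_less[OF r, of i "Suc i"] i by simp
    then have "j < r ! Suc i - 1" using j by linarith
    then show ?thesis using A[OF i] by (simp add: nth_append)
  qed
  moreover have "length (A ! i) = r ! i \<and> sorted (A ! i) \<and> sum_list (A ! i) = d ! i"
    if i: "i < length r" for i
    using pos i by (simp add: A[OF i] sorted_append sum_list_replicate)
  ultimately have "A \<in> index_matrices r d" by (simp add: index_matrices_def A_def)
  then show ?thesis by blast
qed

lemma proj_point_in_W_component:
  assumes v: "v \<in> ext_power n r" "v \<noteq> (\<lambda>S. 0)"
  shows "\<exists>f\<in>form_vecs n r d. f \<noteq> (\<lambda>S z0 z1. 0) \<and>
    proj_point (\<lambda>S z0 z1. z0 ^ d * v S) = proj_point f"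
proof (intro bexI[of _ "\<lambda>S z0 z1. z0 ^ d * v S"] conjI refl)
  obtain S where "v S \<noteq> 0" using v(2) by auto
  then have "(\<lambda>S z0 z1. z0 ^ d * v S) S 1 (1::complex) \<noteq> 0" by simp
  then show "(\<lambda>S (z0::complex) (z1::complex). z0 ^ d * v S) \<noteq> (\<lambda>S z0 z1. 0)" by metis
  show "(\<lambda>S z0 z1. z0 ^ d * v S) \<in> form_vecs n r d"
    using v(1) power_in_binary_forms by (auto simp: form_vecs_def ext_power_def)
qed

lemma fixed_component_subset_E0:
  assumes A: "A \<in> index_matrices r d"
  shows "fixed_component n A (zero_matrix_like A) \<subseteq> E0 n r d"
proof
  fix Vs assume Vs: "Vs \<in> fixed_component n A (zero_matrix_like A)"
  have lenA: "length A = length r" using A by (simp add: index_matrices_def)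
  have row: "length (A ! i) = r ! i" "sum_list (A ! i) = d ! i" if "i < length r" for i
    using A that by (auto simp: index_matrices_def)
  have lenV: "length Vs = length r" using Vs lenA by (simp add: fixed_component_def)
  have data: "discrete_data n (Vs ! i) (A ! i) (replicate (r ! i) 0)" if "i < length r" for i
    using Vs that lenA row(1)[OF that] by (auto simp: fixed_component_def zero_matrix_like_def)
  have "quotient_hilbert_poly n (Vs ! i) (hilbert_polys n r d ! i)" if i: "i < length r" for i
    using discrete_data_hilbert_poly[OF data[OF i] row(1)[OF i]] i row(2)[OF i]
    by (simp add: hilbert_polys_def)
  then have hquot: "Vs \<in> hquot n (hilbert_polys n r d)"
    using Vs lenV by (simp add: hquot_def fixed_component_def hilbert_polys_def)
  have psi_nth: "psi n r d Vs ! i = psi_component n (r ! i) (d ! i) (Vs ! i)" if "i < length r" for i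
    using that by (simp add: psi_def)
  have psi_i: "\<exists>v\<in>ext_power n (r ! i). v \<noteq> (\<lambda>S. 0) \<and>
      psi n r d Vs ! i = proj_point (\<lambda>S z0 z1. z0 ^ (d ! i) * v S)" if i: "i < length r" for i
    using psi_component_discrete_data[OF data[OF i] row(1)[OF i]]
    unfolding row(2)[OF i] psi_nth[OF i] .
  have "\<exists>f\<in>form_vecs n (r ! i) (d ! i). f \<noteq> (\<lambda>S z0 z1. 0) \<and> psi n r d Vs ! i = proj_point f"
    if i: "i < length r" for i
  proof -
    obtain v where v: "v \<in> ext_power n (r ! i)" "v \<noteq> (\<lambda>S. 0)"
      and eq: "psi n r d Vs ! i = proj_point (\<lambda>S z0 z1. z0 ^ (d ! i) * v S)"
      using psi_i[OF i] by blast
    show ?thesis unfolding eq by (rule proj_point_in_W_component[OF v])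
  qed
  moreover have "length (psi n r d Vs) = length r" by (simp add: psi_def)
  ultimately have "psi n r d Vs \<in> Y0 n r d"
    using psi_i unfolding Y0_def W_space_def by blast
  then show "Vs \<in> E0 n r d" using Vs hquot by (simp add: E0_def fixed_component_def)
qed

lemma E0_subset_fixed_components:
  "E0 n r d \<subseteq> (\<Union>A\<in>index_matrices r d. fixed_component n A (zero_matrix_like A))"
proof
  fix Vs assume Vs: "Vs \<in> E0 n r d"
  then have chain: "Vs \<in> chains n" and lenV: "length Vs = length r" and fixed: "S1_fixed Vs"
    and psi: "psi n r d Vs \<in> Y0 n r d"
    by (auto simp: E0_def hquot_def hilbert_polys_def)
  have "\<exists>a. length a = r ! i \<and> sum_list a = d ! i \<and> discrete_data n (Vs ! i) a (replicate (r ! i) 0)"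
    if i: "i < length r" for i
  proof -
    have "Vs ! i \<in> subsheaves n" using chain lenV i by (auto simp: chains_def)
    moreover have "rotate_sheaf \<theta> (Vs ! i) = Vs ! i" for \<theta>
      using fixed lenV i unfolding S1_fixed_def by (metis nth_map)
    moreover obtain v where "v \<in> ext_power n (r ! i)" "v \<noteq> (\<lambda>S. 0)"
      "psi_component n (r ! i) (d ! i) (Vs ! i) = proj_point (\<lambda>S z0 z1. z0 ^ (d ! i) * v S)"
      using psi i by (auto simp: Y0_def psi_def)
    ultimately show ?thesis by (rule discrete_data_of_psi_component)
  qed
  then obtain \<alpha> where \<alpha>: "\<And>i. i < length r \<Longrightarrow> length (\<alpha> i) = r ! i \<and> sum_list (\<alpha> i) = d ! i \<and>
      discrete_data n (Vs ! i) (\<alpha> i) (replicate (r ! i) 0)"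
    by metis
  define A where "A = map \<alpha> [0..<length r]"
  have lenA: "length A = length r" by (simp add: A_def)
  have A: "length (A ! i) = r ! i" "sum_list (A ! i) = d ! i"
    "discrete_data n (Vs ! i) (A ! i) (replicate (r ! i) 0)" if "i < length r" for i
    using \<alpha>[OF that] that by (simp_all add: A_def)
  have "sorted (A ! i)" if "i < length r" for i
    using A(3)[OF that] by (simp add: discrete_data_def)
  moreover have "A ! Suc i ! j \<le> A ! i ! j" if i: "Suc i < length r" and j: "j < r ! i" for i j
  proof -
    have "fst (Vs ! i) \<subseteq> fst (Vs ! Suc i)"
      using chain lenV i by (simp add: chains_def subsheaf_le_def)
    then show ?thesis
      using discrete_data_antimono[OF A(3) A(3)[OF i], of i j] A(1)[of i] i j by simp
  qed
  ultimately have "A \<in> index_matrices r d" using lenA A by (simp add: index_matrices_def)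
  moreover have "Vs \<in> fixed_component n A (zero_matrix_like A)"
    using chain fixed lenV lenA A by (simp add: fixed_component_def zero_matrix_like_def)
  ultimately show "Vs \<in> (\<Union>A\<in>index_matrices r d. fixed_component n A (zero_matrix_like A))"
    by blast
qed

lemma fixed_component_unique:
  assumes "Vs \<in> fixed_component n A B" "Vs \<in> fixed_component n A' B'"
  shows "A = A'"
proof (rule nth_equalityI)
  show len: "length A = length A'" using assms by (simp add: fixed_component_def)
  show "A ! i = A' ! i" if "i < length A" for i
  proof (rule discrete_data_unique)
    show "discrete_data n (Vs ! i) (A ! i) (B ! i)" "discrete_data n (Vs ! i) (A' ! i) (B' ! i)"
      using assms that len by (simp_all add: fixed_component_def)
  qed
qed

theorem corollary3p1p3:
  fixes n I :: nat and r d :: "nat list"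
  assumes "length r = I" and "length d = I"
    and "sorted_wrt (<) r" and "\<forall>i<I. 0 < r ! i"
  shows "E0 n r d = (\<Union>A\<in>index_matrices r d. fixed_component n A (zero_matrix_like A)) \<and>
         disjoint_family_on (\<lambda>A. fixed_component n A (zero_matrix_like A)) (index_matrices r d) \<and>
         index_matrices r d \<noteq> {}"
proof (intro conjI)
  show "E0 n r d = (\<Union>A\<in>index_matrices r d. fixed_component n A (zero_matrix_like A))"
    using E0_subset_fixed_components fixed_component_subset_E0 by blast
  show "disjoint_family_on (\<lambda>A. fixed_component n A (zero_matrix_like A)) (index_matrices r d)"
    unfolding disjoint_family_on_def using fixed_component_unique by blast
  show "index_matrices r d \<noteq> {}" using index_matrices_nonempty assms by simp
qed

end
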